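(* Let $(v_H,p_H)$, with $v_H(t)\in V_H$ and $p_H(t)\in Q_H$ for $0\le t\le T$, be a solution of the mixed GMsFEM: for all $w\in V_H$ and all $q\in Q_H$, $$\int_{\Omega} \kappa \frac{\partial v_H}{\partial t} \cdot w - \int_{\Omega} p^{(I)}_H \nabla \cdot w + \sum_{E \in \mathcal{E}_p^0} \int_E p_H^{(B)} [ w \cdot n] = 0,$$ $$\int_{\Omega} \rho \frac{\partial p_H}{\partial t} q + \int_{\Omega} q^{(I)} \nabla \cdot v_H - \sum_{E\in \mathcal{E}_p^0} \int_E q^{(B)} [ v_H \cdot n] = \int_{\Omega} f q .$$ Then: (i) if $f=0$, the energy is conserved: $$\frac{d}{dt}\, \frac{1}{2} \big( \|v_H\|_V^2 + \|p_H\|_Q^2 \big) = 0;$$ (ii) if the initial values are zero, $v_H(0)=0$ and $p_H(0)=0$, then $$\max_{0\leq t\leq T} \Big( \| v_H(t, \cdot )\|^2_V + \|p_H(t,\cdot)\|^2_Q \Big) \leq 4 \Big( \int_0^T \| \rho^{-1} f(t,\cdot) \|_Q \,dt\Big)^2 .$$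
   Context: Problem data. $\Omega\subset\mathbb{R}^2$ is a polygonal domain, $T>0$, $\kappa,\rho$ are positive coefficients on $\Omega$ bounded above and away from zero, and $f$ is a given source on $[0,T]\times\Omega$ (regular enough in time). The underlying wave equation is $\kappa\,\partial_t v+\nabla p=0$, $\rho\,\partial_t p+\nabla\cdot v=f$ in $\Omega$, with $p=0$ on $\partial\Omega$. Norms: $\|v\|_V^2=\int_\Omega\kappa\,|v|^2$ and $\|p\|_Q^2=\int_\Omega\rho\,p^2$. Meshes. $\mathcal{T}^H_0$ is an initial conforming triangulation of $\Omega$; $\mathcal{T}^H$ (the coarse mesh) is obtained by dividing each triangle of $\mathcal{T}^H_0$ into three by joining its centroid to its vertices. $\mathcal{E}_p$ is the set of edges of $\mathcal{T}^H_0$, $\mathcal{E}_p^0$ the set of those not on $\partial\Omega$, $\mathcal{E}_v$ the set of new edges, $\mathcal{E}^H=\mathcal{E}_p\cup\mathcal{E}_v$. $\mathcal{T}^h$ (the fine mesh, mesh size $h$) is a conforming refinement of $\mathcal{T}^H$, with edge set $\mathcal{E}^h$. $V_h$ is the lowest order Raviart-Thomas (RT0) space on $\mathcal{T}^h$ and $Q_h$ the space of piecewise constants on $\mathcal{T}^h$. For $K\in\mathcal{T}^H$, $V_h(K)$, $Q_h(K)$ are their restrictions to $K$, $V_{h,0}(K)$ is the subspace of $V_h(K)$ with zero normal component on $\partial K$, and $\overline{Q}_h(K)=\{q\in Q_h(K):\int_K q=0\}$, of dimension $M_K$. For each $E\in\mathcal{E}^H$, $\omega_E$ is the union of the coarse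 elements having $E$ as an edge, and $n$ on $E$ is a fixed unit normal. On $E\in\mathcal{E}_p^0$ the jump is $[w\cdot n]=w|_{K_1}\cdot n_1+w|_{K_2}\cdot n_2$, where $K_1,K_2$ are the coarse elements sharing $E$ and $n_i$ is the outward normal of $K_i$. Divergences are taken elementwise. First basis set. $Q_H^{(1)}$ is the space of piecewise constants on $\mathcal{T}^H$. For $E\in\mathcal{E}^H$, $\phi_E^{(1)}$ is supported in $\omega_E$ and, for each coarse $K\subset\omega_E$, together with some $r\in Q_h(K)$ it satisfies $\phi_E^{(1)}|_K\in V_h(K)$, $\int_K\kappa\,\phi_E^{(1)}\cdot w-\int_K r\,\nabla\cdot w=0$ for all $w\in V_{h,0}(K)$, $\int_K q\,\nabla\cdot\phi_E^{(1)}=\int_K c_E\,q$ for all $q\in Q_h(K)$, $\phi_E^{(1)}\cdot n=1$ on $E$ and $=0$ on $\partial K\setminus E$; here $c_E$ is the constant $|E|/|K|$ with the sign on $K$ dictated by the divergence theorem. $V_H^{(1)}=\mathrm{span}\{\phi_E^{(1)}:E\in\mathcal{E}^H\}$. Second basis set. For $E\in\mathcal{E}^H$ let $\overline{D}_E=\mathrm{span}\{\delta_{E,i}: i=1,\dots,N_E\}$ be the ($N_E$-dimensional) space of mean-zero functions on $E$ that are piecewise constant with respect to the fine edges contained in $E$. $\psi_{E,i}^{(2)}$ is supported in $\omega_E$ and, for each coarse $K\subset\omega_E$, together with some $r\in Q_h(K)$ it satisfies $\psi_{E,i}^{(2)}|_K\in V_h(K)$, $\int_K\kappa\,\psi_{E,i}^{(2)}\cdot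 w-\int_K r\,\nabla\cdot w=0$ for all $w\in V_{h,0}(K)$, $\int_K q\,\nabla\cdot\psi_{E,i}^{(2)}=0$ for all $q\in Q_h(K)$, $\psi_{E,i}^{(2)}\cdot n=\delta_{E,i}$ on $E$ and $=0$ on $\partial K\setminus E$. On $V_{E,\mathrm{snap}}^{(2)}=\mathrm{span}\{\psi_{E,i}^{(2)}\}_{i=1}^{N_E}$ consider the spectral problem $\int_E(\phi\cdot n)(w\cdot n)=\lambda\int_{\omega_E}\kappa\,\phi\cdot w$ for all $w\in V_{E,\mathrm{snap}}^{(2)}$, with eigenvalues $\lambda_{E,1}\le\dots\le\lambda_{E,N_E}$ and eigenfunctions $\phi_{E,j}^{(2)}$ normalized by $\int_E(\phi_{E,i}^{(2)}\cdot n)(\phi_{E,j}^{(2)}\cdot n)=\delta_{ij}$. Choose $n_E\le N_E$ and set $V_{E,\mathrm{off}}^{(2)}=\mathrm{span}\{\phi_{E,j}^{(2)}:1\le j\le n_E\}$. Decoupling. $\widehat{V}_H^{(1)}$ (resp. $\widehat{V}_{E,\mathrm{off}}^{(2)}$) is obtained from $V_H^{(1)}$ (resp. $V_{E,\mathrm{off}}^{(2)}$) by dropping normal continuity across the edges in $\mathcal{E}_p^0$: for $E\in\mathcal{E}_p^0$ each basis function $\phi$ attached to $E$ is replaced by the two functions $\phi\,1_{K_1}$, $\phi\,1_{K_2}$, where $\omega_E=K_1\cup K_2$; for other edges nothing changes. $\widehat{V}_H^{(2)}=\sum_{E\in\mathcal{E}^H}\widehat{V}_{E,\mathrm{off}}^{(2)}$.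 Edge pressures. For $E\in\mathcal{E}_p$, $\mathcal{K}_E^h$ is the set of fine triangles having an edge contained in $E$. Given a function $g$ on $E$, constant on each fine edge in $E$, its lift is the function $q$ supported in the union of $\mathcal{K}_E^h$ such that for each $\tau\in\mathcal{K}_E^h$ with fine edge $e\subset E$: $q|_\tau\in P^1(\tau)$, $q|_e=g|_e$ and $\int_\tau q=0$ (so $q$ is continuous across $E$). $p_E^{(1)}$ is the lift of $1$, $p_{E,j}^{(2)}$ the lift of $\phi_{E,j}^{(2)}\cdot n$, $Q_{E,\mathrm{off}}^{(2)}=\mathrm{span}\{p_E^{(1)},p_{E,1}^{(2)},\dots,p_{E,n_E}^{(2)}\}$ and $\widehat{Q}_{H,0}^{(2)}=\sum_{E\in\mathcal{E}_p^0}Q_{E,\mathrm{off}}^{(2)}$. Third basis set. For $K\in\mathcal{T}^H$ consider: find $\psi\in V_{h,0}(K)$, $p\in\overline{Q}_h(K)$, $\mu\in\mathbb{R}$ with $\int_K\kappa\,\psi\cdot w-\int_K p\,\nabla\cdot w=0$ for all $w\in V_{h,0}(K)$ and $\int_K q\,\nabla\cdot\psi=\mu\int_K\rho\,p\,q$ for all $q\in\overline{Q}_h(K)$; eigenvalues $\mu_{K,1}\le\dots\le\mu_{K,M_K}$, eigenfunctions $(\phi_{K,j}^{(3)},p_{K,j}^{(3)})$ (extended by zero outside $K$) with $\int_K\rho\,p_{K,i}^{(3)}p_{K,j}^{(3)}=\delta_{ij}$. Choose $m_K\le M_K$; $V_H^{(3)}$ and $Q_H^{(3)}$ are the spans over all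 $K\in\mathcal{T}^H$ of $\phi_{K,j}^{(3)}$ and $p_{K,j}^{(3)}$, $1\le j\le m_K$, respectively. Multiscale spaces. $V_H=\widehat{V}_H^{(1)}+\widehat{V}_H^{(2)}+V_H^{(3)}$ and $Q_H=Q_H^{(1)}+\widehat{Q}_{H,0}^{(2)}+Q_H^{(3)}$. For $q\in Q_H$, $q^{(B)}$ is its component in $\widehat{Q}_{H,0}^{(2)}$ and $q^{(I)}$ its component in $Q_H^{(1)}+Q_H^{(3)}$, so $q=q^{(I)}+q^{(B)}$. *)

theory Defs
  imports "HOL-Analysis.Analysis" "HOL-Library.Function_Algebras" "HOL-Library.Set_Algebras"
begin

text \<open>
  Functions with values in a real vector space form a real vector space, so that
  \<open>span\<close> and \<open>dim\<close> apply to finite element spaces.  Sums of subspaces are the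
  set sums of \<open>Set_Algebras\<close>.
\<close>

instantiation "fun" :: (type, real_vector) real_vector
begin

definition scaleR_fun :: "real \<Rightarrow> ('a \<Rightarrow> 'b) \<Rightarrow> 'a \<Rightarrow> 'b" where
  "scaleR_fun c f = (\<lambda>x. c *\<^sub>R f x)"

instance
  by standard (auto simp: scaleR_fun_def fun_eq_iff scaleR_add_right scaleR_add_left)

end

type_synonym pt = "real^2"
type_synonym cell = "pt set"
type_synonym edge = "pt set"

text \<open>
  A piecewise (broken) function assigns to each fine triangle a polynomial on the whole
  plane.  In this way a discontinuous function has a well-defined trace on an edge
  from each side.  By convention the value on a set that is not a fine triangle is 0.
\<close>

type_synonym 'b pw = "cell \<Rightarrow> pt \<Rightarrow> 'b"


section \<open>Domain and meshes\<close>

text \<open>The equation \<open>interior (closure \<Omega>) = \<Omega>\<close> excludes slits.\<close>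

definition polygonal_domain :: "pt set \<Rightarrow> bool" where
  "polygonal_domain \<Omega> \<longleftrightarrow> open \<Omega> \<and> connected \<Omega> \<and> bounded \<Omega> \<and> \<Omega> \<noteq> {} \<and>
     interior (closure \<Omega>) = \<Omega> \<and>
     (\<exists>S. finite S \<and> (\<forall>s\<in>S. \<exists>a b. s = closed_segment a b) \<and> frontier \<Omega> = \<Union>S)"

definition conforming_mesh :: "pt set \<Rightarrow> cell set \<Rightarrow> bool" where
  "conforming_mesh \<Omega> \<T> \<longleftrightarrow>
     triangulation \<T> \<and> (\<forall>K\<in>\<T>. 2 simplex K) \<and> \<Union>\<T> = closure \<Omega>"

definition centroid :: "cell \<Rightarrow> pt" where
  "centroid K = (1/3) *\<^sub>R (\<Sum>a | a extreme_point_of K. a)"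

definition out_normal :: "cell \<Rightarrow> edge \<Rightarrow> pt" where
  "out_normal K E = (THE n. norm n = 1 \<and> (\<forall>x\<in>E. \<forall>y\<in>K. n \<bullet> (y - x) \<le> 0))"

definition line_integral :: "edge \<Rightarrow> (pt \<Rightarrow> real) \<Rightarrow> real" where
  "line_integral e g =
     (let (a, b) = (SOME (a, b). e = closed_segment a b)
      in dist a b * (LINT s:{0..1}|lborel. g (linepath a b s)))"

text \<open>
  All data of the method.  The fields \<open>nrm\<close> to \<open>mK\<close> are, in this order: the fixed
  unit normals on coarse edges; \<open>\<phi>\<^sub>E\<^sup>(\<^sup>1\<^sup>)\<close>; \<open>\<delta>\<^sub>E\<^sub>,\<^sub>i\<close> (by its value on each fine edge);
  \<open>\<psi>\<^sub>E\<^sub>,\<^sub>i\<^sup>(\<^sup>2\<^sup>)\<close>; the eigenpairs \<open>\<lambda>\<^sub>E\<^sub>,\<^sub>j\<close>, \<open>\<phi>\<^sub>E\<^sub>,\<^sub>j\<^sup>(\<^sup>2\<^sup>)\<close>; the number \<open>n\<^sub>E\<close> of them that is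
  kept; the eigentriples \<open>\<mu>\<^sub>K\<^sub>,\<^sub>j\<close>, \<open>\<phi>\<^sub>K\<^sub>,\<^sub>j\<^sup>(\<^sup>3\<^sup>)\<close>, \<open>p\<^sub>K\<^sub>,\<^sub>j\<^sup>(\<^sup>3\<^sup>)\<close>; and the number \<open>m\<^sub>K\<close> of them that
  is kept.
\<close>

record gmsfem =
  Dom :: "pt set"
  kappa :: "pt \<Rightarrow> real"
  rho :: "pt \<Rightarrow> real"
  mesh0 :: "cell set"
  mesh :: "cell set"
  nrm :: "edge \<Rightarrow> pt"
  phi1 :: "edge \<Rightarrow> pt pw"
  delta :: "edge \<Rightarrow> nat \<Rightarrow> edge \<Rightarrow> real"
  psi2 :: "edge \<Rightarrow> nat \<Rightarrow> pt pw"
  lam2 :: "edge \<Rightarrow> nat \<Rightarrow> real"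
  phi2 :: "edge \<Rightarrow> nat \<Rightarrow> pt pw"
  nE :: "edge \<Rightarrow> nat"
  mu3 :: "cell \<Rightarrow> nat \<Rightarrow> real"
  phi3 :: "cell \<Rightarrow> nat \<Rightarrow> pt pw"
  p3 :: "cell \<Rightarrow> nat \<Rightarrow> real pw"
  mK :: "cell \<Rightarrow> nat"

definition coarse :: "gmsfem \<Rightarrow> cell set" where
  "coarse D = {convex hull (insert (centroid K) E) | K E. K \<in> mesh0 D \<and> E edge_of K}"

definition edges_p :: "gmsfem \<Rightarrow> edge set" where
  "edges_p D = {E. \<exists>K\<in>mesh0 D. E edge_of K}"

definition edges_p0 :: "gmsfem \<Rightarrow> edge set" where
  "edges_p0 D = {E \<in> edges_p D. \<not> E \<subseteq> frontier (Dom D)}"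

definition edges_v :: "gmsfem \<Rightarrow> edge set" where
  "edges_v D = {closed_segment (centroid K) a | K a. K \<in> mesh0 D \<and> a extreme_point_of K}"

definition edges_H :: "gmsfem \<Rightarrow> edge set" where
  "edges_H D = edges_p D \<union> edges_v D"

definition adj :: "gmsfem \<Rightarrow> edge \<Rightarrow> cell set" where
  "adj D E = {K \<in> coarse D. E edge_of K}"

definition omega :: "gmsfem \<Rightarrow> edge \<Rightarrow> pt set" where
  "omega D E = \<Union>(adj D E)"

definition fine_edges :: "gmsfem \<Rightarrow> edge \<Rightarrow> edge set" where
  "fine_edges D E = {e. e \<subseteq> E \<and> (\<exists>\<tau>\<in>mesh D. e edge_of \<tau>)}"

definition mesh_setting :: "gmsfem \<Rightarrow> bool" where
  "mesh_setting D \<longleftrightarrow>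
     polygonal_domain (Dom D) \<and> conforming_mesh (Dom D) (mesh0 D) \<and>
     conforming_mesh (Dom D) (mesh D) \<and> (\<forall>\<tau>\<in>mesh D. \<exists>K\<in>coarse D. \<tau> \<subseteq> K) \<and>
     (\<forall>E\<in>edges_H D. norm (nrm D E) = 1 \<and> (\<forall>x\<in>E. \<forall>y\<in>E. nrm D E \<bullet> (x - y) = 0))"

definition coefficient :: "pt set \<Rightarrow> (pt \<Rightarrow> real) \<Rightarrow> bool" where
  "coefficient \<Omega> c \<longleftrightarrow> c \<in> borel_measurable (lebesgue_on \<Omega>) \<and>
     (\<exists>c0 c1. 0 < c0 \<and> (\<forall>x\<in>\<Omega>. c0 \<le> c x \<and> c x \<le> c1))"


section \<open>Integrals, divergence, traces\<close>

text \<open>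
  Integral of a piecewise function over a union \<open>S\<close> of fine triangles.  The open
  triangles are used because the coefficients are only given on the open set \<open>\<Omega>\<close>.
\<close>

definition pw_integral :: "gmsfem \<Rightarrow> pt set \<Rightarrow> real pw \<Rightarrow> real" where
  "pw_integral D S g = (\<Sum>\<tau> | \<tau> \<in> mesh D \<and> \<tau> \<subseteq> S. LINT x:interior \<tau>|lebesgue. g \<tau> x)"

definition dom_integral :: "gmsfem \<Rightarrow> real pw \<Rightarrow> real" where
  "dom_integral D g = pw_integral D (closure (Dom D)) g"

definition pw_div :: "pt pw \<Rightarrow> real pw" where
  "pw_div v = (\<lambda>\<tau> x. \<Sum>b\<in>Basis. frechet_derivative (v \<tau>) (at x) b \<bullet> b)"

definition restr :: "cell \<Rightarrow> 'b::zero pw \<Rightarrow> 'b pw" where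
  "restr K v = (\<lambda>\<tau>. if \<tau> \<subseteq> K then v \<tau> else 0)"

text \<open>The fine triangle on the \<open>K\<close>-side of a fine edge \<open>e\<close> contained in \<open>\<partial>K\<close>.\<close>

definition side :: "gmsfem \<Rightarrow> cell \<Rightarrow> edge \<Rightarrow> cell" where
  "side D K e = (THE \<tau>. \<tau> \<in> mesh D \<and> \<tau> \<subseteq> K \<and> e edge_of \<tau>)"

text \<open>
  Value on a fine edge of a function that is continuous across it; any adjacent
  triangle may be used.
\<close>

definition etrace :: "gmsfem \<Rightarrow> 'b pw \<Rightarrow> edge \<Rightarrow> pt \<Rightarrow> 'b" where
  "etrace D q e = q (SOME \<tau>. \<tau> \<in> mesh D \<and> e edge_of \<tau>)"

text \<open>The normal trace of a field whose normal component is continuous across \<open>E\<close>.\<close>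

definition ntrace :: "gmsfem \<Rightarrow> edge \<Rightarrow> pt pw \<Rightarrow> edge \<Rightarrow> pt \<Rightarrow> real" where
  "ntrace D E v = (\<lambda>e x. etrace D v e x \<bullet> nrm D E)"

definition jump :: "gmsfem \<Rightarrow> edge \<Rightarrow> pt pw \<Rightarrow> edge \<Rightarrow> pt \<Rightarrow> real" where
  "jump D E w = (\<lambda>e x. \<Sum>K\<in>adj D E. w (side D K e) x \<bullet> out_normal K E)"

definition edge_integral :: "gmsfem \<Rightarrow> edge \<Rightarrow> (edge \<Rightarrow> pt \<Rightarrow> real) \<Rightarrow> real" where
  "edge_integral D E g = (\<Sum>e\<in>fine_edges D E. line_integral e (g e))"

definition normV :: "gmsfem \<Rightarrow> pt pw \<Rightarrow> real" where
  "normV D v = sqrt (dom_integral D (\<lambda>\<tau> x. kappa D x * (norm (v \<tau> x))\<^sup>2))"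

definition normQ :: "gmsfem \<Rightarrow> real pw \<Rightarrow> real" where
  "normQ D q = sqrt (dom_integral D (\<lambda>\<tau> x. rho D x * (q \<tau> x)\<^sup>2))"


section \<open>Fine scale spaces\<close>

definition Vh :: "gmsfem \<Rightarrow> pt pw set" where
  "Vh D = {v. (\<forall>\<tau>\<in>mesh D. \<exists>a b. v \<tau> = (\<lambda>x. a + b *\<^sub>R x)) \<and> (\<forall>\<tau>. \<tau> \<notin> mesh D \<longrightarrow> v \<tau> = 0) \<and>
     (\<forall>\<tau>1\<in>mesh D. \<forall>\<tau>2\<in>mesh D. \<forall>e. \<tau>1 \<noteq> \<tau>2 \<and> e edge_of \<tau>1 \<and> e edge_of \<tau>2 \<longrightarrow>
        (\<forall>x\<in>e. v \<tau>1 x \<bullet> out_normal \<tau>1 e + v \<tau>2 x \<bullet> out_normal \<tau>2 e = 0))}"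

definition Qh :: "gmsfem \<Rightarrow> real pw set" where
  "Qh D = {q. (\<forall>\<tau>\<in>mesh D. \<exists>c. q \<tau> = (\<lambda>x. c)) \<and> (\<forall>\<tau>. \<tau> \<notin> mesh D \<longrightarrow> q \<tau> = 0)}"

definition VhK :: "gmsfem \<Rightarrow> cell \<Rightarrow> pt pw set" where
  "VhK D K = restr K ` Vh D"

definition QhK :: "gmsfem \<Rightarrow> cell \<Rightarrow> real pw set" where
  "QhK D K = restr K ` Qh D"

definition Vh0 :: "gmsfem \<Rightarrow> cell \<Rightarrow> pt pw set" where
  "Vh0 D K = {v \<in> VhK D K. \<forall>E. E edge_of K \<longrightarrow>
     (\<forall>e\<in>fine_edges D E. \<forall>x\<in>e. v (side D K e) x \<bullet> out_normal K E = 0)}"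

definition QhK_mean0 :: "gmsfem \<Rightarrow> cell \<Rightarrow> real pw set" where
  "QhK_mean0 D K = {q \<in> QhK D K. pw_integral D K q = 0}"

definition MK :: "gmsfem \<Rightarrow> cell \<Rightarrow> nat" where
  "MK D K = dim (QhK_mean0 D K)"


section \<open>Multiscale basis functions\<close>

text \<open>
  The local problems that define the first two basis sets: divergence \<open>c K\<close> on each
  coarse element \<open>K\<close> in \<open>\<omega>\<^sub>E\<close>, normal component \<open>g\<close> on \<open>E\<close>, and 0 on \<open>\<partial>K - E\<close>.
\<close>

definition edge_problem ::
  "gmsfem \<Rightarrow> edge \<Rightarrow> (cell \<Rightarrow> real) \<Rightarrow> (edge \<Rightarrow> real) \<Rightarrow> pt pw \<Rightarrow> bool" where
  "edge_problem D E c g \<phi> \<longleftrightarrow>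
     (\<forall>\<tau>. (\<forall>K\<in>adj D E. \<not> \<tau> \<subseteq> K) \<longrightarrow> \<phi> \<tau> = 0) \<and>
     (\<forall>K\<in>adj D E. restr K \<phi> \<in> VhK D K \<and>
        (\<exists>r\<in>QhK D K. \<forall>w\<in>Vh0 D K.
           pw_integral D K (\<lambda>\<tau> x. kappa D x * (\<phi> \<tau> x \<bullet> w \<tau> x))
           - pw_integral D K (\<lambda>\<tau> x. r \<tau> x * pw_div w \<tau> x) = 0) \<and>
        (\<forall>q\<in>QhK D K. pw_integral D K (\<lambda>\<tau> x. q \<tau> x * pw_div \<phi> \<tau> x)
           = pw_integral D K (\<lambda>\<tau> x. c K * q \<tau> x)) \<and>
        (\<forall>e\<in>fine_edges D E. \<forall>x\<in>e. \<phi> (side D K e) x \<bullet> nrm D E = g e) \<and>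
        (\<forall>E'. E' edge_of K \<and> E' \<noteq> E \<longrightarrow>
           (\<forall>e\<in>fine_edges D E'. \<forall>x\<in>e. \<phi> (side D K e) x \<bullet> out_normal K E' = 0)))"

text \<open>The sign \<open>n \<bullet> n\<^sub>K\<close> below is that of the flux of \<open>\<phi>\<close> out of \<open>K\<close>; \<open>|E|\<close> is the diameter.\<close>

definition basis1 :: "gmsfem \<Rightarrow> bool" where
  "basis1 D \<longleftrightarrow> (\<forall>E\<in>edges_H D. edge_problem D E
     (\<lambda>K. (nrm D E \<bullet> out_normal K E) * (diameter E / measure lebesgue K)) (\<lambda>e. 1) (phi1 D E))"

definition Dbar :: "gmsfem \<Rightarrow> edge \<Rightarrow> (edge \<Rightarrow> real) set" where
  "Dbar D E = {d. (\<forall>e. e \<notin> fine_edges D E \<longrightarrow> d e = 0) \<and> edge_integral D E (\<lambda>e x. d e) = 0}"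

definition NE :: "gmsfem \<Rightarrow> edge \<Rightarrow> nat" where
  "NE D E = dim (Dbar D E)"

definition Vsnap :: "gmsfem \<Rightarrow> edge \<Rightarrow> pt pw set" where
  "Vsnap D E = span (psi2 D E ` {1..NE D E})"

definition basis2 :: "gmsfem \<Rightarrow> bool" where
  "basis2 D \<longleftrightarrow> (\<forall>E\<in>edges_H D.
     span (delta D E ` {1..NE D E}) = Dbar D E \<and>
     (\<forall>i\<in>{1..NE D E}. edge_problem D E (\<lambda>K. 0) (delta D E i) (psi2 D E i)) \<and>
     mono_on {1..NE D E} (lam2 D E) \<and>
     (\<forall>j\<in>{1..NE D E}. phi2 D E j \<in> Vsnap D E \<and>
        (\<forall>w\<in>Vsnap D E.
           edge_integral D E (\<lambda>e x. ntrace D E (phi2 D E j) e x * ntrace D E w e x)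
           = lam2 D E j *
             pw_integral D (omega D E) (\<lambda>\<tau> x. kappa D x * (phi2 D E j \<tau> x \<bullet> w \<tau> x)))) \<and>
     (\<forall>i\<in>{1..NE D E}. \<forall>j\<in>{1..NE D E}.
        edge_integral D E (\<lambda>e x. ntrace D E (phi2 D E i) e x * ntrace D E (phi2 D E j) e x)
        = (if i = j then 1 else 0)) \<and>
     nE D E \<le> NE D E)"

definition basis3 :: "gmsfem \<Rightarrow> bool" where
  "basis3 D \<longleftrightarrow> (\<forall>K\<in>coarse D.
     mono_on {1..MK D K} (mu3 D K) \<and>
     (\<forall>j\<in>{1..MK D K}. phi3 D K j \<in> Vh0 D K \<and> p3 D K j \<in> QhK_mean0 D K \<and>
        (\<forall>w\<in>Vh0 D K.
           pw_integral D K (\<lambda>\<tau> x. kappa D x * (phi3 D K j \<tau> x \<bullet> w \<tau> x))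
           - pw_integral D K (\<lambda>\<tau> x. p3 D K j \<tau> x * pw_div w \<tau> x) = 0) \<and>
        (\<forall>q\<in>QhK_mean0 D K.
           pw_integral D K (\<lambda>\<tau> x. q \<tau> x * pw_div (phi3 D K j) \<tau> x)
           = mu3 D K j * pw_integral D K (\<lambda>\<tau> x. rho D x * (p3 D K j \<tau> x * q \<tau> x)))) \<and>
     (\<forall>i\<in>{1..MK D K}. \<forall>j\<in>{1..MK D K}.
        pw_integral D K (\<lambda>\<tau> x. rho D x * (p3 D K i \<tau> x * p3 D K j \<tau> x))
        = (if i = j then 1 else 0)) \<and>
     mK D K \<le> MK D K)"

definition gmsfem_setting :: "gmsfem \<Rightarrow> bool" where
  "gmsfem_setting D \<longleftrightarrow> mesh_setting D \<and>
     coefficient (Dom D) (kappa D) \<and> coefficient (Dom D) (rho D) \<and>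
     basis1 D \<and> basis2 D \<and> basis3 D"


section \<open>Multiscale spaces\<close>

definition decouple :: "gmsfem \<Rightarrow> edge \<Rightarrow> pt pw \<Rightarrow> pt pw set" where
  "decouple D E \<phi> = (if E \<in> edges_p0 D then {restr K \<phi> | K. K \<in> adj D E} else {\<phi>})"

definition V1hat :: "gmsfem \<Rightarrow> pt pw set" where
  "V1hat D = span (\<Union>E\<in>edges_H D. decouple D E (phi1 D E))"

definition V2hat_off :: "gmsfem \<Rightarrow> edge \<Rightarrow> pt pw set" where
  "V2hat_off D E = span (\<Union>j\<in>{1..nE D E}. decouple D E (phi2 D E j))"

definition V2hat :: "gmsfem \<Rightarrow> pt pw set" where
  "V2hat D = (\<Sum>E\<in>edges_H D. V2hat_off D E)"

definition V3 :: "gmsfem \<Rightarrow> pt pw set" where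
  "V3 D = span {phi3 D K j | K j. K \<in> coarse D \<and> j \<in> {1..mK D K}}"

definition VH :: "gmsfem \<Rightarrow> pt pw set" where
  "VH D = V1hat D + V2hat D + V3 D"

text \<open>
  The lift of \<open>g\<close> is zero off the fine triangles with an edge in \<open>E\<close>;
  a triangle has at most one such edge.
\<close>

definition edge_lift :: "gmsfem \<Rightarrow> edge \<Rightarrow> (edge \<Rightarrow> pt \<Rightarrow> real) \<Rightarrow> real pw" where
  "edge_lift D E g = (THE q.
     (\<forall>\<tau>. \<not> (\<tau> \<in> mesh D \<and> (\<exists>e. e edge_of \<tau> \<and> e \<subseteq> E)) \<longrightarrow> q \<tau> = 0) \<and>
     (\<forall>\<tau>\<in>mesh D. \<forall>e. e edge_of \<tau> \<and> e \<subseteq> E \<longrightarrow>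
        (\<exists>a b. q \<tau> = (\<lambda>x. a + b \<bullet> x)) \<and> (\<forall>x\<in>e. q \<tau> x = g e x) \<and>
        pw_integral D \<tau> q = 0))"

definition Q2_off :: "gmsfem \<Rightarrow> edge \<Rightarrow> real pw set" where
  "Q2_off D E = span (insert (edge_lift D E (\<lambda>e x. 1))
     {edge_lift D E (ntrace D E (phi2 D E j)) | j. j \<in> {1..nE D E}})"

definition Q2hat0 :: "gmsfem \<Rightarrow> real pw set" where
  "Q2hat0 D = (\<Sum>E\<in>edges_p0 D. Q2_off D E)"

definition Q1 :: "gmsfem \<Rightarrow> real pw set" where
  "Q1 D = {q. (\<forall>K\<in>coarse D. \<exists>c. \<forall>\<tau>\<in>mesh D. \<tau> \<subseteq> K \<longrightarrow> q \<tau> = (\<lambda>x. c)) \<and>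
     (\<forall>\<tau>. \<tau> \<notin> mesh D \<longrightarrow> q \<tau> = 0)}"

definition Q3 :: "gmsfem \<Rightarrow> real pw set" where
  "Q3 D = span {p3 D K j | K j. K \<in> coarse D \<and> j \<in> {1..mK D K}}"

definition QH :: "gmsfem \<Rightarrow> real pw set" where
  "QH D = Q1 D + Q2hat0 D + Q3 D"

text \<open>
  The components of \<open>q \<in> QH D\<close>.  They are unique: functions in \<open>Q2hat0 D\<close> have mean zero
  on every fine triangle, those in \<open>Q1 D + Q3 D\<close> are constant there.
\<close>

definition compB :: "gmsfem \<Rightarrow> real pw \<Rightarrow> real pw" where
  "compB D q = (THE b. b \<in> Q2hat0 D \<and> q - b \<in> Q1 D + Q3 D)"

definition compI :: "gmsfem \<Rightarrow> real pw \<Rightarrow> real pw" where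
  "compI D q = q - compB D q"


section \<open>Semidiscrete solutions\<close>

text \<open>
  Time derivatives are taken on each fine triangle and at each point, one-sided at
  the ends of \<open>[0,T]\<close>.  On the finite-dimensional spaces \<open>VH D\<close> and \<open>QH D\<close> this is the derivative
  of the coefficients.
\<close>

definition time_diff :: "real \<Rightarrow> (real \<Rightarrow> 'b::real_normed_vector pw) \<Rightarrow> bool" where
  "time_diff T u \<longleftrightarrow>
     (\<forall>t\<in>{0..T}. \<forall>\<tau> x. (\<lambda>s. u s \<tau> x) differentiable (at t within {0..T}))"

definition time_deriv :: "real \<Rightarrow> (real \<Rightarrow> 'b::real_normed_vector pw) \<Rightarrow> real \<Rightarrow> 'b pw" where
  "time_deriv T u t = (\<lambda>\<tau> x. vector_derivative (\<lambda>s. u s \<tau> x) (at t within {0..T}))"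

definition solution ::
  "gmsfem \<Rightarrow> real \<Rightarrow> (real \<Rightarrow> pt \<Rightarrow> real) \<Rightarrow> (real \<Rightarrow> pt pw) \<Rightarrow> (real \<Rightarrow> real pw) \<Rightarrow> bool" where
  "solution D T f v p \<longleftrightarrow>
     time_diff T v \<and> time_diff T p \<and>
     (\<forall>t\<in>{0..T}. v t \<in> VH D \<and> p t \<in> QH D \<and>
       (\<forall>w\<in>VH D.
          dom_integral D (\<lambda>\<tau> x. kappa D x * (time_deriv T v t \<tau> x \<bullet> w \<tau> x))
          - dom_integral D (\<lambda>\<tau> x. compI D (p t) \<tau> x * pw_div w \<tau> x)
          + (\<Sum>E\<in>edges_p0 D.
               edge_integral D E (\<lambda>e x. etrace D (compB D (p t)) e x * jump D E w e x)) = 0) \<and>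
       (\<forall>q\<in>QH D.
          dom_integral D (\<lambda>\<tau> x. rho D x * (time_deriv T p t \<tau> x * q \<tau> x))
          + dom_integral D (\<lambda>\<tau> x. compI D q \<tau> x * pw_div (v t) \<tau> x)
          - (\<Sum>E\<in>edges_p0 D.
               edge_integral D E (\<lambda>e x. etrace D (compB D q) e x * jump D E (v t) e x))
          = dom_integral D (\<lambda>\<tau> x. f t x * q \<tau> x)))"

text \<open>The source is taken in \<open>L\<^sup>1(0,T;L\<^sup>2(\<Omega>))\<close>, with \<open>f t \<in> L\<^sup>2(\<Omega>)\<close> for every \<open>t\<close>.\<close>

definition source :: "gmsfem \<Rightarrow> real \<Rightarrow> (real \<Rightarrow> pt \<Rightarrow> real) \<Rightarrow> bool" where
  "source D T f \<longleftrightarrow>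
     (\<forall>t\<in>{0..T}. f t \<in> borel_measurable (lebesgue_on (Dom D)) \<and>
        integrable (lebesgue_on (Dom D)) (\<lambda>x. (f t x)\<^sup>2)) \<and>
     set_integrable lebesgue {0..T} (\<lambda>t. normQ D (\<lambda>\<tau> x. f t x / rho D x))"

end

theory Submission
  imports Defs
begin

text \<open>
  The proof is the energy argument.  Testing both equations with the solution itself makes the
  coupling terms cancel (\<open>energy_identity\<close>): at each time the derivative of
  \<open>\<parallel>v\<parallel>\<^sup>2 + \<parallel>p\<parallel>\<^sup>2\<close> is twice the integral of \<open>f p\<close>.  For \<open>f = 0\<close> this is conservation of energy.  In
  general the weighted Cauchy-Schwarz inequality bounds it by \<open>2 \<parallel>f / \<rho>\<parallel> \<parallel>p\<parallel>\<close>
  (\<open>source_Cauchy_Schwarz\<close>), and integration up to the time of maximal energy gives the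
  estimate (\<open>energy_bound\<close>).

  The work lies in the differentiation of the norms in time, because the solution is only known to
  be differentiable at each point.  Members of the multiscale spaces are affine on every
  fine triangle (\<open>VH_pwP1\<close>, \<open>QH_pwP1\<close>), so on a triangle they are determined by three nodal values;
  the norms are quadratic forms in these with coefficients constant in time
  (\<open>mass_expansion\<close>), and the product rule suffices (\<open>mass_derivative\<close>).

  That the velocities are piecewise affine is immediate from the Raviart-Thomas spaces.  For the
  edge pressures it depends on the lift from an edge being well defined (\<open>edge_lift_P1\<close>):
  an affine function on a triangle with given values on one edge is determined up to a multiple of
  the height above that edge, and the height has a nonzero integral.
\<close>

section \<open>Affine functions\<close>

text \<open>
  The nodal basis of the affine functions for the nodes \<open>0\<close> and \<open>b \<in> Basis\<close>, that is, the
  barycentric coordinates of the reference simplex.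
\<close>
definition hat :: "'a::euclidean_space \<Rightarrow> 'a \<Rightarrow> real" where
  "hat y x = (if y = 0 then 1 - (\<Sum>b\<in>Basis. x \<bullet> b) else x \<bullet> y)"

text \<open>
  The affine functions, described by interpolation at the nodes.  With this description the
  coordinates of a function are point values, and so a family of affine functions that is
  differentiable in time at each point has differentiable coordinates.
\<close>
definition P1 :: "('a::euclidean_space \<Rightarrow> 'b::real_vector) set" where
  "P1 = {u. \<forall>x. u x = (\<Sum>y\<in>insert 0 Basis. hat y x *\<^sub>R u y)}"

lemma sum_hat:
  fixes g :: "'a::euclidean_space \<Rightarrow> 'b::real_vector"
  shows "(\<Sum>y\<in>insert 0 Basis. hat y x *\<^sub>R g y) = g 0 + (\<Sum>b\<in>Basis. (x \<bullet> b) *\<^sub>R (g b - g 0))"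
proof -
  have "(\<Sum>b\<in>Basis. hat b x *\<^sub>R g b) = (\<Sum>b\<in>Basis. (x \<bullet> b) *\<^sub>R g b)"
    by (rule sum.cong) (auto simp: hat_def nonzero_Basis)
  moreover have "hat 0 x *\<^sub>R g 0 = g 0 - (\<Sum>b\<in>Basis. (x \<bullet> b) *\<^sub>R g 0)"
    by (simp add: hat_def scaleR_left_diff_distrib scaleR_sum_left)
  ultimately show ?thesis
    by (simp add: scaleR_right_diff_distrib sum_subtractf)
qed

lemma P1D: "u \<in> P1 \<Longrightarrow> u x = (\<Sum>y\<in>insert 0 Basis. hat y x *\<^sub>R u y)"
  unfolding P1_def by (erule CollectE) (erule spec)

lemma continuous_hat: "continuous_on S (hat y)"
  unfolding hat_def by (cases "y = 0") (auto intro!: continuous_intros)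

lemma subspace_P1: "subspace P1"
  unfolding subspace_def
proof (intro conjI ballI allI)
  show "0 \<in> P1"
    by (simp add: P1_def)
next
  fix u w :: "'a \<Rightarrow> 'b"
  assume "u \<in> P1" "w \<in> P1"
  then show "u + w \<in> P1"
    unfolding P1_def mem_Collect_eq plus_fun_apply scaleR_add_right sum.distrib by metis
next
  fix r :: real and u :: "'a \<Rightarrow> 'b"
  assume "u \<in> P1"
  then show "r *\<^sub>R u \<in> P1"
    unfolding P1_def mem_Collect_eq scaleR_fun_def scaleR_left_commute[of _ r] scaleR_sum_right[symmetric]
    by metis
qed

lemmas zero_in_P1 = subspace_0[OF subspace_P1]
lemmas add_in_P1 = subspace_add[OF subspace_P1]
lemmas scale_in_P1 = subspace_scale[OF subspace_P1]
lemmas diff_in_P1 = subspace_diff[OF subspace_P1]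

lemma P1_affine:
  assumes "linear L"
  shows "(\<lambda>x. a + L x) \<in> P1"
proof -
  interpret linear L by fact
  have "L x = (\<Sum>b\<in>Basis. (x \<bullet> b) *\<^sub>R L b)" for x
  proof -
    have "L x = L (\<Sum>b\<in>Basis. (x \<bullet> b) *\<^sub>R b)"
      by (simp only: euclidean_representation)
    then show ?thesis
      by (simp only: sum scale)
  qed
  then show ?thesis
    unfolding P1_def mem_Collect_eq sum_hat zero add_0_right add_diff_cancel_left' by metis
qed

lemma P1_const: "(\<lambda>x. c) \<in> P1"
  unfolding P1_def mem_Collect_eq sum_hat by simp

lemma P1_inner_right: "(\<lambda>x. a + b \<bullet> x) \<in> P1"
  by (intro P1_affine bounded_linear.linear bounded_linear_inner_right)

lemma P1_scale: "(\<lambda>x. a + b *\<^sub>R x) \<in> P1"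
  by (intro P1_affine bounded_linear.linear bounded_linear_scaleR_right)

lemma P1_inner:
  assumes "u \<in> P1"
  shows "(\<lambda>x. u x \<bullet> n) \<in> P1"
  unfolding P1_def mem_Collect_eq
proof
  fix x
  have "u x = (\<Sum>y\<in>insert 0 Basis. hat y x *\<^sub>R u y)"
    using assms by (rule P1D)
  then have "u x \<bullet> n = (\<Sum>y\<in>insert 0 Basis. hat y x *\<^sub>R u y) \<bullet> n"
    by (rule arg_cong)
  then show "u x \<bullet> n = (\<Sum>y\<in>insert 0 Basis. hat y x *\<^sub>R (u y \<bullet> n))"
    by (simp only: inner_sum_left inner_scaleR_left real_scaleR_def)
qed

lemma P1_real:
  fixes u :: "'a::euclidean_space \<Rightarrow> real"
  shows "u \<in> P1 \<longleftrightarrow> (\<exists>a b. u = (\<lambda>x. a + b \<bullet> x))"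
proof
  assume u: "u \<in> P1"
  have "u x = u 0 + (\<Sum>b\<in>Basis. (u b - u 0) *\<^sub>R b) \<bullet> x" for x
  proof -
    have "u x = u 0 + (\<Sum>b\<in>Basis. (x \<bullet> b) *\<^sub>R (u b - u 0))"
      using P1D[OF u, of x] unfolding sum_hat .
    also have "\<dots> = u 0 + (\<Sum>b\<in>Basis. (u b - u 0) *\<^sub>R b) \<bullet> x"
      unfolding inner_sum_left inner_scaleR_left real_scaleR_def
      by (simp only: mult.commute inner_commute)
    finally show ?thesis .
  qed
  then have "u = (\<lambda>x. u 0 + (\<Sum>b\<in>Basis. (u b - u 0) *\<^sub>R b) \<bullet> x)"
    by (rule ext)
  then show "\<exists>a b. u = (\<lambda>x. a + b \<bullet> x)" by (intro exI)
qed (auto intro: P1_inner_right)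

lemma continuous_P1:
  fixes u :: "'a::euclidean_space \<Rightarrow> 'b::real_normed_vector"
  assumes "u \<in> P1"
  shows "continuous_on S u"
proof -
  have "continuous_on S (\<lambda>x. \<Sum>y\<in>insert 0 Basis. hat y x *\<^sub>R u y)"
    by (intro continuous_intros continuous_hat)
  then show ?thesis
    by (rule continuous_on_eq) (rule P1D[OF assms, symmetric])
qed

section \<open>Weighted integrals on a cell\<close>

lemma set_lebesgue_integral_eq_lebesgue_on:
  fixes g :: "'a::euclidean_space \<Rightarrow> real"
  assumes "A \<in> sets lebesgue"
  shows "(LINT x:A|lebesgue. g x) = integral\<^sup>L (lebesgue_on A) g"
  using assms by (simp add: set_lebesgue_integral_def integral_restrict_space)

text \<open>
  A coefficient and a continuous function are both bounded on a bounded set contained in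
  \<open>\<Omega>\<close>, which has finite measure.
\<close>
lemma coefficient_integrable:
  assumes c: "coefficient \<Omega> c" and A: "A \<subseteq> \<Omega>" "open A" "bounded A"
    and g: "continuous_on UNIV g"
  shows "integrable (lebesgue_on A) (\<lambda>x. c x * g x)"
proof -
  obtain c0 c1 where c01: "0 < c0" "\<And>x. x \<in> \<Omega> \<Longrightarrow> c0 \<le> c x \<and> c x \<le> c1"
    using c unfolding coefficient_def by blast
  have "compact (g ` closure A)"
    using A(3) g by (intro compact_continuous_image) (auto intro: continuous_on_subset)
  then obtain B where B: "\<And>x. x \<in> A \<Longrightarrow> \<bar>g x\<bar> \<le> B"
    by (metis compact_imp_bounded bounded_pos closure_subset imageI real_norm_def subset_iff)
  have A': "A \<in> lmeasurable"
    using A(2,3) lmeasurable_open by blast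
  then interpret finite_measure "lebesgue_on A"
    by (rule finite_measure_lebesgue_on)
  have gm: "g \<in> borel_measurable (lebesgue_on A)"
    using continuous_imp_measurable_on_sets_lebesgue[OF continuous_on_subset[OF g]] A' by blast
  have cm: "c \<in> borel_measurable (lebesgue_on A)"
    using c A(1) unfolding coefficient_def by (blast intro: measurable_restrict_mono)
  have "\<bar>c x * g x\<bar> \<le> c1 * B" if "x \<in> A" for x
    unfolding abs_mult using c01(1) c01(2)[of x] B[OF that] that A(1)
    by (intro mult_mono) force+
  then show ?thesis
    using gm cm by (intro integrable_const_bound[of _ "c1 * B"]) auto
qed

context
  fixes \<Omega> A :: "pt set" and c :: "pt \<Rightarrow> real"
  assumes c: "coefficient \<Omega> c" and A: "A \<subseteq> \<Omega>" "open A" "bounded A"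
begin

lemma mass_integrable:
  fixes u w :: "pt \<Rightarrow> 'b::real_inner"
  assumes "u \<in> P1" "w \<in> P1"
  shows "integrable (lebesgue_on A) (\<lambda>x. c x * (u x \<bullet> w x))"
  by (intro coefficient_integrable[OF c A] continuous_intros continuous_P1 assms)

text \<open>
  The weighted inner product is a fixed bilinear form in the nodal values, given by the mass
  matrix of the reference nodes.  All dependence on time sits in the nodal values.
\<close>
lemma mass_expansion:
  fixes u w :: "pt \<Rightarrow> 'b::real_inner"
  assumes "u \<in> P1" "w \<in> P1"
  shows "(LINT x:A|lebesgue. c x * (u x \<bullet> w x)) =
    (\<Sum>y\<in>insert 0 Basis. \<Sum>z\<in>insert 0 Basis. (u y \<bullet> w z) * (LINT x|lebesgue_on A. c x * (hat y x * hat z x)))"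
proof -
  have "(\<lambda>x. c x * (u x \<bullet> w x)) =
    (\<lambda>x. \<Sum>y\<in>insert 0 Basis. \<Sum>z\<in>insert 0 Basis. (u y \<bullet> w z) * (c x * (hat y x * hat z x)))"
  proof
    fix x
    have "u x \<bullet> w x = (\<Sum>y\<in>insert 0 Basis. hat y x *\<^sub>R u y) \<bullet> (\<Sum>z\<in>insert 0 Basis. hat z x *\<^sub>R w z)"
      by (rule arg_cong2[where f = inner]; rule P1D; fact)
    also have "\<dots> = (\<Sum>y\<in>insert 0 Basis. \<Sum>z\<in>insert 0 Basis. (u y \<bullet> w z) * (hat y x * hat z x))"
      unfolding inner_sum_left
      unfolding inner_sum_right inner_scaleR_left inner_scaleR_right
      by (simp only: mult_ac)
    finally show "c x * (u x \<bullet> w x) =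
      (\<Sum>y\<in>insert 0 Basis. \<Sum>z\<in>insert 0 Basis. (u y \<bullet> w z) * (c x * (hat y x * hat z x)))"
      by (simp only: sum_distrib_left mult.left_commute[of "c x"])
  qed
  moreover have "integrable (lebesgue_on A) (\<lambda>x. c x * (hat y x * hat z x))" for y z
    by (intro coefficient_integrable[OF c A] continuous_intros continuous_hat)
  ultimately show ?thesis
    using A(2) by (simp add: set_lebesgue_integral_eq_lebesgue_on del: sum.insert)
qed

text \<open>
  The mass matrix does not depend on time, so the integral is a finite sum of products of nodal
  values with constant coefficients, and the product rule gives its derivative.
\<close>
lemma mass_derivative:
  fixes u :: "real \<Rightarrow> pt \<Rightarrow> 'b::real_inner"
  assumes u: "\<And>s. s \<in> S \<Longrightarrow> u s \<in> P1" and t: "t \<in> S" "at t within S \<noteq> bot"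
    and u': "\<And>x. ((\<lambda>s. u s x) has_vector_derivative u' x) (at t within S)"
  shows "((\<lambda>s. LINT x:A|lebesgue. c x * (norm (u s x))\<^sup>2) has_real_derivative
      2 * (LINT x:A|lebesgue. c x * (u' x \<bullet> u t x))) (at t within S)"
proof -
  \<comment> \<open>The derivative inherits the nodal expansion, because derivatives within \<open>S\<close> are unique.\<close>
  have "u' \<in> P1"
    unfolding P1_def mem_Collect_eq
  proof
    fix x
    have "((\<lambda>s. \<Sum>y\<in>insert 0 Basis. hat y x *\<^sub>R u s y) has_vector_derivative
        (\<Sum>y\<in>insert 0 Basis. hat y x *\<^sub>R u' y)) (at t within S)"
      by (intro has_vector_derivative_sum bounded_linear.has_vector_derivative
          [OF bounded_linear_scaleR_right] u')
    then have "((\<lambda>s. u s x) has_vector_derivative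
        (\<Sum>y\<in>insert 0 Basis. hat y x *\<^sub>R u' y)) (at t within S)"
      by (rule has_vector_derivative_transform[OF t(1), rotated])
        (intro P1D u)
    with u' show "u' x = (\<Sum>y\<in>insert 0 Basis. hat y x *\<^sub>R u' y)"
      using t(2) vector_derivative_unique_within by blast
  qed
  let ?m = "\<lambda>y z. LINT x|lebesgue_on A. c x * (hat y x * hat z x)"
  have "((\<lambda>s. u s y \<bullet> u s z) has_real_derivative (u' y \<bullet> u t z + u t y \<bullet> u' z)) (at t within S)" for y z
    using bounded_bilinear.has_vector_derivative[OF bounded_bilinear_inner u' u', of y z]
    by (simp add: has_real_derivative_iff_has_vector_derivative add.commute)
  then have "((\<lambda>s. \<Sum>y\<in>insert 0 Basis. \<Sum>z\<in>insert 0 Basis. (u s y \<bullet> u s z) * ?m y z) has_real_derivative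
      (\<Sum>y\<in>insert 0 Basis. \<Sum>z\<in>insert 0 Basis. (u' y \<bullet> u t z + u t y \<bullet> u' z) * ?m y z)) (at t within S)"
    by (intro DERIV_sum DERIV_cmult_right)
  moreover have "(\<Sum>y\<in>insert 0 Basis. \<Sum>z\<in>insert 0 Basis. (u' y \<bullet> u t z + u t y \<bullet> u' z) * ?m y z)
      = 2 * (LINT x:A|lebesgue. c x * (u' x \<bullet> u t x))"
  proof -
    have "(\<Sum>y\<in>insert 0 Basis. \<Sum>z\<in>insert 0 Basis. (u' y \<bullet> u t z + u t y \<bullet> u' z) * ?m y z)
      = (LINT x:A|lebesgue. c x * (u' x \<bullet> u t x)) + (LINT x:A|lebesgue. c x * (u t x \<bullet> u' x))"
      unfolding mass_expansion[OF \<open>u' \<in> P1\<close> u[OF t(1)]] mass_expansion[OF u[OF t(1)] \<open>u' \<in> P1\<close>]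
      by (simp only: distrib_right sum.distrib)
    then show ?thesis by (simp add: inner_commute)
  qed
  ultimately have "((\<lambda>s. \<Sum>y\<in>insert 0 Basis. \<Sum>z\<in>insert 0 Basis. (u s y \<bullet> u s z) * ?m y z) has_real_derivative
      2 * (LINT x:A|lebesgue. c x * (u' x \<bullet> u t x))) (at t within S)"
    by simp
  then show ?thesis
    by (rule has_field_derivative_transform_within[OF _ zero_less_one t(1)])
      (simp only: power2_norm_eq_inner, intro mass_expansion[symmetric] u)
qed

end

section \<open>The edge lift\<close>

lemma triangle_interior_nonempty:
  fixes \<tau> :: "pt set"
  assumes "2 simplex \<tau>"
  shows "interior \<tau> \<noteq> {}"
proof -
  have dim: "aff_dim \<tau> = 2" and "convex \<tau>"
    using assms by (auto dest: aff_dim_simplex convex_simplex)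
  then have "affine hull \<tau> = UNIV"
    using aff_dim_eq_full[of \<tau>] by simp
  moreover have "\<tau> \<noteq> {}"
    using dim by auto
  ultimately show ?thesis
    using rel_interior_interior rel_interior_eq_empty[OF \<open>convex \<tau>\<close>] by blast
qed

text \<open>
  The distance to the line through an edge, up to a positive factor.  It exists because every
  face of a polyhedron is cut out by a supporting hyperplane.
\<close>
lemma edge_height:
  fixes \<tau> :: "pt set"
  assumes "2 simplex \<tau>" and "e edge_of \<tau>"
  obtains l where "l \<in> P1" and "\<And>x. x \<in> e \<Longrightarrow> l x = (0::real)"
    and "\<And>x. x \<in> interior \<tau> \<Longrightarrow> 0 < l x"
proof -
  have "e exposed_face_of \<tau>"
    using assms by (simp add: exposed_face_of_polyhedron simplex_imp_polyhedron edge_of_def)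
  moreover have "e \<noteq> {}" "e \<noteq> \<tau>"
    using assms aff_dim_simplex[OF assms(1)] by (auto simp: edge_of_def)
  ultimately obtain a b where ab: "a \<noteq> 0" "\<tau> \<subseteq> {x. a \<bullet> x \<le> b}" "e = \<tau> \<inter> {x. a \<bullet> x = b}"
    unfolding exposed_face_of by blast
  have "interior \<tau> \<subseteq> {x. a \<bullet> x < b}"
    using interior_mono[OF ab(2)] ab(1) by simp
  moreover have "(\<lambda>x. b + (- a) \<bullet> x) \<in> P1"
    by (rule P1_inner_right)
  ultimately show thesis
    using that[of "\<lambda>x. b + (- a) \<bullet> x"] ab(3) by auto
qed

text \<open>
  The zeros of an affine function form an affine set.  As \<open>l\<close> vanishes on \<open>e\<close> but not at \<open>z\<close>, the
  point \<open>z\<close> is off the line through \<open>e\<close>, and the edge together with \<open>z\<close> spans the plane.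
\<close>
lemma P1_zero_on_edge:
  fixes e :: "pt set" and d :: "pt \<Rightarrow> real"
  assumes "aff_dim e = 1" and "d \<in> P1" and "\<And>x. x \<in> e \<Longrightarrow> d x = 0"
    and "l \<in> P1" and "\<And>x. x \<in> e \<Longrightarrow> l x = 0" and "l z \<noteq> (0::real)" and "d z = 0"
  shows "d = 0"
proof -
  have affine_zeros: "affine {x. u x = 0}" if "u \<in> P1" for u :: "pt \<Rightarrow> real"
  proof -
    obtain a b where "u = (\<lambda>x. a + b \<bullet> x)"
      using \<open>u \<in> P1\<close> unfolding P1_real by blast
    then have "{x. u x = 0} = {x. b \<bullet> x = - a}"
      by auto
    then show ?thesis
      by (simp only: affine_hyperplane)
  qed
  have "affine hull e \<subseteq> {x. l x = 0}"
    using assms(5) by (intro hull_minimal affine_zeros assms) auto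
  then have "z \<notin> affine hull e"
    using assms(6) by auto
  then have "aff_dim (insert z e) = DIM(pt)"
    using assms(1) by (simp add: aff_dim_insert)
  then have "affine hull (insert z e) = UNIV"
    using aff_dim_eq_full by blast
  moreover have "affine hull (insert z e) \<subseteq> {x. d x = 0}"
    using assms(3,7) by (intro hull_minimal affine_zeros assms) auto
  ultimately show ?thesis
    by (auto simp: fun_eq_iff)
qed

lemma P1_integrable:
  fixes u :: "pt \<Rightarrow> real"
  assumes "open A" and "bounded A" and "u \<in> P1"
  shows "integrable (lebesgue_on A) u"
proof -
  have "coefficient A (\<lambda>x. 1)"
    unfolding coefficient_def by (auto intro!: exI[of _ 1])
  from coefficient_integrable[OF this subset_refl assms(1,2) continuous_P1[OF assms(3)]]
  show ?thesis
    by simp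
qed

lemma integral_pos_open:
  fixes l :: "pt \<Rightarrow> real"
  assumes "open A" and "A \<noteq> {}" and "integrable (lebesgue_on A) l" and "\<And>x. x \<in> A \<Longrightarrow> 0 < l x"
  shows "integral\<^sup>L (lebesgue_on A) l \<noteq> 0"
proof
  assume 0: "integral\<^sup>L (lebesgue_on A) l = 0"
  have A: "A \<in> sets lebesgue"
    using assms(1) by auto
  then have A': "A \<inter> space lebesgue \<in> sets lebesgue"
    by simp
  have "AE x in lebesgue_on A. l x = 0"
    using 0 integral_nonneg_eq_0_iff_AE[OF assms(3)] assms(4) A
    by (simp add: AE_restrict_space_iff less_imp_le)
  then have "AE x in lebesgue. x \<notin> A"
    unfolding AE_restrict_space_iff[OF A']
    by eventually_elim (use assms(4) in force)
  then have "A \<in> null_sets lebesgue"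
    using A by (simp add: AE_iff_null_sets)
  then show False
    using open_not_negligible[OF assms(1,2)] negligible_iff_null_sets by blast
qed

text \<open>
  The affine functions with the values of \<open>g\<close> on \<open>e\<close> are exactly \<open>g - r l\<close>, where \<open>l\<close> is the height
  above the edge.  As \<open>l\<close> is positive inside the triangle its integral is not zero, so exactly
  one \<open>r\<close> makes the integral vanish.
\<close>
lemma P1_extension_ex1:
  fixes \<tau> :: "pt set" and g :: "pt \<Rightarrow> real"
  assumes \<tau>: "2 simplex \<tau>" and e: "e edge_of \<tau>" and g: "g \<in> P1"
  shows "\<exists>!u. u \<in> P1 \<and> (\<forall>x\<in>e. u x = g x) \<and> (LINT x:interior \<tau>|lebesgue. u x) = 0"
proof -
  let ?M = "lebesgue_on (interior \<tau>)"
  have bd: "open (interior \<tau>)" "bounded (interior \<tau>)"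
    using \<tau> by (auto simp: compact_simplex compact_imp_bounded bounded_interior)
  obtain l where l: "l \<in> P1" "\<And>x. x \<in> e \<Longrightarrow> l x = (0::real)"
    "\<And>x. x \<in> interior \<tau> \<Longrightarrow> 0 < l x"
    using edge_height[OF \<tau> e] by blast
  have int: "integrable ?M u" if "u \<in> P1" for u :: "pt \<Rightarrow> real"
    using P1_integrable bd that by blast
  have eq: "(LINT x:interior \<tau>|lebesgue. u x) = integral\<^sup>L ?M u" for u :: "pt \<Rightarrow> real"
    by (simp add: set_lebesgue_integral_eq_lebesgue_on)
  have l0: "integral\<^sup>L ?M l \<noteq> 0"
    using integral_pos_open[OF bd(1) triangle_interior_nonempty[OF \<tau>] int[OF l(1)] l(3)] .
  obtain z where z: "z \<in> interior \<tau>"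
    using triangle_interior_nonempty[OF \<tau>] by blast
  show ?thesis
    unfolding eq
  proof (rule ex_ex1I)
    define r where "r = integral\<^sup>L ?M g / integral\<^sup>L ?M l"
    have "g - r *\<^sub>R l \<in> P1"
      using g l(1) by (intro diff_in_P1 scale_in_P1)
    moreover have "integral\<^sup>L ?M (g - r *\<^sub>R l) = integral\<^sup>L ?M g - r * integral\<^sup>L ?M l"
      using int[OF g] int[OF l(1)] by (simp add: fun_diff_def scaleR_fun_def)
    ultimately have "g - r *\<^sub>R l \<in> P1 \<and> (\<forall>x\<in>e. (g - r *\<^sub>R l) x = g x) \<and> integral\<^sup>L ?M (g - r *\<^sub>R l) = 0"
      using l(2) l0 by (simp add: r_def scaleR_fun_def)
    then show "\<exists>u. u \<in> P1 \<and> (\<forall>x\<in>e. u x = g x) \<and> integral\<^sup>L ?M u = 0"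
      by blast
  next
    fix u1 u2 :: "pt \<Rightarrow> real"
    assume "u1 \<in> P1 \<and> (\<forall>x\<in>e. u1 x = g x) \<and> integral\<^sup>L ?M u1 = 0"
      and "u2 \<in> P1 \<and> (\<forall>x\<in>e. u2 x = g x) \<and> integral\<^sup>L ?M u2 = 0"
    then have u: "u1 \<in> P1" "u2 \<in> P1" "\<And>x. x \<in> e \<Longrightarrow> u1 x = u2 x"
      "integral\<^sup>L ?M u1 = 0" "integral\<^sup>L ?M u2 = 0"
      by auto
    \<comment> \<open>The factor is chosen such that the difference below also vanishes at \<open>z\<close>.\<close>
    define r where "r = (u1 z - u2 z) / l z"
    have "u1 - u2 - r *\<^sub>R l = 0"
    proof (rule P1_zero_on_edge[OF _ _ _ l(1), where z = z])
      show "aff_dim e = 1"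
        using e by (simp add: edge_of_def)
      show "u1 - u2 - r *\<^sub>R l \<in> P1"
        using u l(1) by (intro diff_in_P1 scale_in_P1)
    qed (use u l(2) l(3)[OF z] in \<open>auto simp: scaleR_fun_def r_def\<close>)
    then have d: "u1 - u2 = r *\<^sub>R l"
      by simp
    have "integral\<^sup>L ?M (u1 - u2) = 0"
      using int u by (simp add: fun_diff_def)
    then have "r = 0"
      unfolding d using l0 by (simp add: scaleR_fun_def)
    then show "u1 = u2"
      using d by simp
  qed
qed

lemma conforming_meshD:
  assumes "conforming_mesh \<Omega> \<T>"
  shows "finite \<T>" and "\<And>\<tau>. \<tau> \<in> \<T> \<Longrightarrow> 2 simplex \<tau>"
    and "\<And>\<tau> \<sigma>. \<tau> \<in> \<T> \<Longrightarrow> \<sigma> \<in> \<T> \<Longrightarrow> \<tau> \<inter> \<sigma> face_of \<tau>"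
    and "\<And>\<tau>. \<tau> \<in> \<T> \<Longrightarrow> \<tau> \<subseteq> closure \<Omega>"
  using assms unfolding conforming_mesh_def triangulation_def by blast+

lemma conforming_mesh_subset_eq:
  assumes "conforming_mesh \<Omega> \<T>" and "\<sigma> \<in> \<T>" and "\<tau> \<in> \<T>" and "\<sigma> \<subseteq> \<tau>"
  shows "\<sigma> = \<tau>"
proof (rule ccontr)
  assume "\<sigma> \<noteq> \<tau>"
  moreover have "\<sigma> face_of \<tau>"
    using conforming_meshD(3)[OF assms(1,3,2)] assms(4) by (simp add: Int_absorb1)
  moreover have dims: "2 simplex \<sigma>" "2 simplex \<tau>"
    using assms conforming_meshD(2) by blast+
  ultimately have "aff_dim \<sigma> < aff_dim \<tau>"
    using face_of_aff_dim_lt[OF convex_simplex] by blast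
  with dims show False
    by (simp add: aff_dim_simplex)
qed

lemma pw_integral_cell:
  assumes "conforming_mesh \<Omega> (mesh D)" and "\<tau> \<in> mesh D"
  shows "pw_integral D \<tau> q = (LINT x:interior \<tau>|lebesgue. q \<tau> x)"
proof -
  have "{\<sigma> \<in> mesh D. \<sigma> \<subseteq> \<tau>} = {\<tau>}"
    using assms conforming_mesh_subset_eq by blast
  then show ?thesis
    by (simp add: pw_integral_def)
qed

text \<open>
  A face is the intersection of its affine hull with the polytope, and both edges have the
  line through \<open>E\<close> as affine hull.
\<close>
lemma edge_in_line_unique:
  assumes "convex \<tau>" and "e edge_of \<tau>" and "e' edge_of \<tau>"
    and "e \<subseteq> E" and "e' \<subseteq> E" and "aff_dim E = 1"
  shows "e = e'"
proof -
  have *: "d = affine hull E \<inter> \<tau>" if d: "d edge_of \<tau>" "d \<subseteq> E" for d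
  proof -
    have "d \<noteq> {}"
      using d(1) unfolding edge_of_def by force
    then have "affine hull d = affine hull E"
      using d assms(6) by (intro affine_dim_equal hull_mono) (auto simp: edge_of_def)
    moreover have "affine hull d \<inter> \<tau> = d"
      using d by (intro face_of_imp_eq_affine_Int[symmetric] assms(1)) (simp add: edge_of_def)
    ultimately show ?thesis
      by simp
  qed
  show ?thesis
    using *[OF assms(2,4)] *[OF assms(3,5)] by (rule trans[OF _ sym])
qed

text \<open>
  The lift is defined by a definite description, so nothing is known about it before existence
  and uniqueness are shown.  Both are local: a triangle has at most one edge in \<open>E\<close>, and on
  that triangle the previous results determine the function.
\<close>
lemma edge_lift_P1:
  assumes mesh: "conforming_mesh \<Omega> (mesh D)" and E: "aff_dim E = 1"
    and g: "\<And>\<tau> e. \<tau> \<in> mesh D \<Longrightarrow> e edge_of \<tau> \<Longrightarrow> g e \<in> P1"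
  shows "edge_lift D E g \<tau> \<in> P1"
proof -
  let ?near = "\<lambda>\<tau>. \<tau> \<in> mesh D \<and> (\<exists>e. e edge_of \<tau> \<and> e \<subseteq> E)"
  let ?sol = "\<lambda>\<tau> u. \<forall>e. e edge_of \<tau> \<and> e \<subseteq> E \<longrightarrow>
    u \<in> P1 \<and> (\<forall>x\<in>e. u x = g e x) \<and> (LINT x:interior \<tau>|lebesgue. u x) = 0"
  let ?lift = "\<lambda>q. (\<forall>\<tau>. \<not> ?near \<tau> \<longrightarrow> q \<tau> = 0) \<and> (\<forall>\<tau>\<in>mesh D. ?sol \<tau> (q \<tau>))"
  have ex1: "\<exists>!u. ?sol \<tau> u" if "?near \<tau>" for \<tau>
  proof -
    obtain e where e: "\<tau> \<in> mesh D" "e edge_of \<tau>" "e \<subseteq> E"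
      using \<open>?near \<tau>\<close> by blast
    have \<tau>: "2 simplex \<tau>"
      using conforming_meshD(2)[OF mesh e(1)] .
    have "e' = e" if "e' edge_of \<tau>" "e' \<subseteq> E" for e'
      using edge_in_line_unique[OF convex_simplex[OF \<tau>] that(1) e(2) that(2) e(3) E] .
    then have "?sol \<tau> = (\<lambda>u. u \<in> P1 \<and> (\<forall>x\<in>e. u x = g e x) \<and> (LINT x:interior \<tau>|lebesgue. u x) = 0)"
      using e by (intro ext) blast
    then show ?thesis
      using P1_extension_ex1[OF \<tau> e(2) g[OF e(1,2)]] by simp
  qed
  have "\<exists>!q. ?lift q"
  proof (rule ex_ex1I)
    define q where "q = (\<lambda>\<tau>. if ?near \<tau> then THE u. ?sol \<tau> u else 0)"
    have "?sol \<tau> (q \<tau>)" if "?near \<tau>" for \<tau>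
      using theI'[OF ex1[OF that]] that by (simp only: q_def if_True simp_thms)
    moreover have "q \<tau> = 0" if "\<not> ?near \<tau>" for \<tau>
      using that by (simp only: q_def if_False)
    ultimately have "?lift q"
      by blast
    then show "\<exists>q. ?lift q"
      by (intro exI[where P = ?lift])
    show "q1 = q2" if "?lift q1" "?lift q2" for q1 q2
    proof
      fix \<tau>
      show "q1 \<tau> = q2 \<tau>"
      proof (cases "?near \<tau>")
        case True
        then have "?sol \<tau> (q1 \<tau>)" "?sol \<tau> (q2 \<tau>)"
          using that by blast+
        then show ?thesis
          using ex1[OF True] by blast
      next
        case False
        then show ?thesis
          using that by metis
      qed
    qed
  qed
  then have "?lift (THE q. ?lift q)"
    by (rule theI')
  moreover have "edge_lift D E g = (THE q. ?lift q)"
    unfolding edge_lift_def P1_real[symmetric]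
    by (simp only: pw_integral_cell[OF mesh] cong: ball_cong)
  ultimately have "?lift (edge_lift D E g)"
    by (simp only:)
  then show ?thesis
    by (cases "?near \<tau>") (auto simp: zero_in_P1)
qed

section \<open>The multiscale spaces consist of piecewise affine functions\<close>

definition pwP1 :: "gmsfem \<Rightarrow> 'b::real_vector pw set" where
  "pwP1 D = {u. \<forall>\<tau>\<in>mesh D. u \<tau> \<in> P1}"

lemma subspace_pwP1: "subspace (pwP1 D)"
  unfolding subspace_def
proof (intro conjI ballI allI)
  show "0 \<in> pwP1 D"
    by (simp add: pwP1_def zero_in_P1)
next
  fix u w :: "'a pw"
  assume "u \<in> pwP1 D" "w \<in> pwP1 D"
  then show "u + w \<in> pwP1 D"
    by (simp add: pwP1_def add_in_P1)
next
  fix c and u :: "'a pw"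
  assume "u \<in> pwP1 D"
  then show "c *\<^sub>R u \<in> pwP1 D"
    by (simp add: pwP1_def scale_in_P1 scaleR_fun_def[of c u])
qed

lemma set_plus_subset_subspace:
  assumes "subspace S" "A \<subseteq> S" "B \<subseteq> S"
  shows "A + B \<subseteq> S"
  using assms by (auto simp: set_plus_def intro: subspace_add)

lemma set_sum_subset_subspace:
  assumes "subspace S" "\<And>i. i \<in> I \<Longrightarrow> A i \<subseteq> S"
  shows "(\<Sum>i\<in>I. A i) \<subseteq> S"
  using assms(2)
proof (induction I rule: infinite_finite_induct)
  case (insert i I)
  then show ?case
    using set_plus_subset_subspace[OF assms(1)] by simp
qed (use subspace_0[OF assms(1)] in auto)

lemma restr_pwP1: "u \<in> pwP1 D \<Longrightarrow> restr K u \<in> pwP1 D"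
  by (simp add: pwP1_def restr_def zero_in_P1)

lemma Vh_pwP1: "Vh D \<subseteq> pwP1 D"
proof
  fix v
  assume "v \<in> Vh D"
  then have *: "\<exists>a b. v \<tau> = (\<lambda>x. a + b *\<^sub>R x)" if "\<tau> \<in> mesh D" for \<tau>
    using that unfolding Vh_def by (elim CollectE conjE) (rule bspec)
  have "v \<tau> \<in> P1" if "\<tau> \<in> mesh D" for \<tau>
    using *[OF that] P1_scale by (elim exE) (erule ssubst)
  then show "v \<in> pwP1 D"
    unfolding pwP1_def by blast
qed

lemma Qh_pwP1: "Qh D \<subseteq> pwP1 D"
proof
  fix q
  assume "q \<in> Qh D"
  then have *: "\<exists>c. q \<tau> = (\<lambda>x. c)" if "\<tau> \<in> mesh D" for \<tau>
    using that unfolding Qh_def by blast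
  have "q \<tau> \<in> P1" if "\<tau> \<in> mesh D" for \<tau>
    using *[OF that] P1_const by (elim exE) (erule ssubst)
  then show "q \<in> pwP1 D"
    unfolding pwP1_def by blast
qed

lemma VhK_pwP1: "VhK D K \<subseteq> pwP1 D"
  unfolding VhK_def by (intro image_subsetI restr_pwP1) (rule subsetD[OF Vh_pwP1])

lemma QhK_pwP1: "QhK D K \<subseteq> pwP1 D"
  unfolding QhK_def by (intro image_subsetI restr_pwP1) (rule subsetD[OF Qh_pwP1])

text \<open>
  The field is Raviart-Thomas on each coarse element next to \<open>E\<close>, and it is zero on the
  triangles outside these elements.
\<close>
lemma edge_problem_pwP1:
  assumes "edge_problem D E c g \<phi>"
  shows "\<phi> \<in> pwP1 D"
  unfolding pwP1_def
proof (intro CollectI ballI)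
  fix \<tau>
  assume \<tau>: "\<tau> \<in> mesh D"
  show "\<phi> \<tau> \<in> P1"
  proof (cases "\<exists>K\<in>adj D E. \<tau> \<subseteq> K")
    case True
    then obtain K where K: "K \<in> adj D E" "\<tau> \<subseteq> K"
      by blast
    from bspec[OF conjunct2[OF assms[unfolded edge_problem_def]] K(1)]
    have "restr K \<phi> \<in> VhK D K"
      by (rule conjunct1)
    then have "restr K \<phi> \<in> pwP1 D"
      using VhK_pwP1 by (rule rev_subsetD)
    then show ?thesis
      using \<tau> K(2) by (auto simp: pwP1_def restr_def)
  next
    case False
    then have "\<forall>K\<in>adj D E. \<not> \<tau> \<subseteq> K"
      by blast
    then have "\<phi> \<tau> = 0"
      by (rule mp[OF spec[OF conjunct1[OF assms[unfolded edge_problem_def]]]])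
    then show ?thesis
      by (simp add: zero_in_P1)
  qed
qed

lemma decouple_pwP1: "\<phi> \<in> pwP1 D \<Longrightarrow> decouple D E \<phi> \<subseteq> pwP1 D"
  unfolding decouple_def using restr_pwP1 by auto

lemma phi2_pwP1:
  assumes "basis2 D" and "E \<in> edges_H D" and "j \<in> {1..nE D E}"
  shows "phi2 D E j \<in> pwP1 D"
proof -
  have "psi2 D E ` {1..NE D E} \<subseteq> pwP1 D"
    using assms unfolding basis2_def by (blast intro: edge_problem_pwP1)
  then have "Vsnap D E \<subseteq> pwP1 D"
    unfolding Vsnap_def by (intro span_minimal subspace_pwP1)
  moreover have "nE D E \<le> NE D E"
    using assms unfolding basis2_def by blast
  then have "j \<in> {1..NE D E}"
    using assms(3) by simp
  then have "phi2 D E j \<in> Vsnap D E"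
    using assms unfolding basis2_def by blast
  ultimately show ?thesis
    by blast
qed

lemma basis3_pwP1:
  assumes "basis3 D" and "K \<in> coarse D" and "j \<in> {1..mK D K}"
  shows "phi3 D K j \<in> pwP1 D" and "p3 D K j \<in> pwP1 D"
proof -
  have "mK D K \<le> MK D K"
    using assms unfolding basis3_def by blast
  then have "j \<in> {1..MK D K}"
    using assms(3) by simp
  then have "phi3 D K j \<in> Vh0 D K" and "p3 D K j \<in> QhK_mean0 D K"
    using assms unfolding basis3_def by blast+
  then show "phi3 D K j \<in> pwP1 D" and "p3 D K j \<in> pwP1 D"
    unfolding Vh0_def QhK_mean0_def using VhK_pwP1 QhK_pwP1 by blast+
qed

lemma VH_pwP1:
  assumes "basis1 D" and "basis2 D" and "basis3 D"
  shows "VH D \<subseteq> pwP1 D"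
proof -
  have "V1hat D \<subseteq> pwP1 D"
    unfolding V1hat_def
    using assms(1) unfolding basis1_def
    by (intro span_minimal subspace_pwP1 UN_least decouple_pwP1) (blast intro: edge_problem_pwP1)
  moreover have "V2hat D \<subseteq> pwP1 D"
    unfolding V2hat_def V2hat_off_def
    by (intro set_sum_subset_subspace span_minimal subspace_pwP1 UN_least decouple_pwP1
        phi2_pwP1 assms)
  moreover have "V3 D \<subseteq> pwP1 D"
    unfolding V3_def
    by (intro span_minimal subspace_pwP1) (use basis3_pwP1(1)[OF assms(3)] in blast)
  ultimately show ?thesis
    unfolding VH_def by (intro set_plus_subset_subspace subspace_pwP1)
qed

text \<open>
  The trace on \<open>e\<close> is the polynomial of one adjacent triangle, extended to the whole plane; this
  is the affine extension that the lift starts from.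
\<close>
lemma ntrace_P1:
  assumes "\<phi> \<in> pwP1 D" and "\<tau> \<in> mesh D" and "e edge_of \<tau>"
  shows "ntrace D E \<phi> e \<in> P1"
proof -
  have "(SOME \<tau>. \<tau> \<in> mesh D \<and> e edge_of \<tau>) \<in> mesh D"
    using someI_ex[of "\<lambda>\<tau>. \<tau> \<in> mesh D \<and> e edge_of \<tau>"] assms by blast
  then show ?thesis
    using assms(1) unfolding ntrace_def etrace_def pwP1_def by (intro P1_inner) blast
qed

text \<open>
  The edge pressures are lifts of functions that are affine on each fine edge; the other
  components are constant on each fine triangle.
\<close>
lemma QH_pwP1:
  assumes "mesh_setting D" and "basis2 D" and "basis3 D"
  shows "QH D \<subseteq> pwP1 D"
proof -
  have mesh: "conforming_mesh (Dom D) (mesh D)"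
    using assms(1) by (simp add: mesh_setting_def)
  have "Q1 D \<subseteq> pwP1 D"
  proof
    fix q
    assume q: "q \<in> Q1 D"
    show "q \<in> pwP1 D"
      unfolding pwP1_def
    proof (intro CollectI ballI)
      fix \<tau>
      assume \<tau>: "\<tau> \<in> mesh D"
      then obtain K where "K \<in> coarse D" "\<tau> \<subseteq> K"
        using assms(1) unfolding mesh_setting_def by blast
      then obtain c where "q \<tau> = (\<lambda>x. c)"
        using q \<tau> unfolding Q1_def by blast
      then show "q \<tau> \<in> P1"
        using P1_const by metis
    qed
  qed
  moreover have "Q2hat0 D \<subseteq> pwP1 D"
    unfolding Q2hat0_def
  proof (intro set_sum_subset_subspace subspace_pwP1)
    fix E
    assume "E \<in> edges_p0 D"
    then have E: "aff_dim E = 1" "E \<in> edges_H D"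
      by (auto simp: edges_p0_def edges_p_def edges_H_def edge_of_def)
    have lift: "edge_lift D E g \<in> pwP1 D"
      if "\<And>\<tau> e. \<tau> \<in> mesh D \<Longrightarrow> e edge_of \<tau> \<Longrightarrow> g e \<in> P1" for g
      unfolding pwP1_def by (intro CollectI ballI edge_lift_P1[OF mesh E(1)] that)
    have "edge_lift D E (\<lambda>e x. 1) \<in> pwP1 D"
      by (intro lift P1_const)
    moreover have "edge_lift D E (ntrace D E (phi2 D E j)) \<in> pwP1 D" if "j \<in> {1..nE D E}" for j
      by (intro lift ntrace_P1[OF phi2_pwP1[OF assms(2) E(2) that]])
    ultimately show "Q2_off D E \<subseteq> pwP1 D"
      unfolding Q2_off_def by (intro span_minimal subspace_pwP1) blast
  qed
  moreover have "Q3 D \<subseteq> pwP1 D"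
    unfolding Q3_def
    by (intro span_minimal subspace_pwP1) (use basis3_pwP1(2)[OF assms(3)] in blast)
  ultimately show ?thesis
    unfolding QH_def by (intro set_plus_subset_subspace subspace_pwP1)
qed

section \<open>Weighted norms on the whole domain\<close>

lemma coefficient_pos: "coefficient \<Omega> c \<Longrightarrow> x \<in> \<Omega> \<Longrightarrow> 0 < c x"
  unfolding coefficient_def by force

text \<open>
  The quadratic polynomial is evaluated at its minimum \<open>s = - c / a\<close>.  If \<open>a = 0\<close> the polynomial
  is linear in \<open>s\<close> and has a sign only if \<open>c = 0\<close>.
\<close>
lemma quadratic_nonneg_imp_Cauchy_Schwarz:
  fixes a b c :: real
  assumes "\<And>s. 0 \<le> s\<^sup>2 * a + 2 * s * c + b" and "0 \<le> a" and "0 \<le> b"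
  shows "c \<le> sqrt a * sqrt b"
proof -
  have "c\<^sup>2 \<le> a * b"
  proof (cases "a = 0")
    case True
    have "c = 0"
    proof (rule ccontr)
      assume "c \<noteq> 0"
      then show False
        using assms(1)[of "- (b + 1) / (2 * c)"] True by (simp add: field_simps)
    qed
    then show ?thesis
      using True by simp
  next
    case False
    then have "0 \<le> b - c\<^sup>2 / a"
      using assms(1)[of "- c / a"] by (simp add: power2_eq_square)
    then show ?thesis
      using False \<open>0 \<le> a\<close> by (simp add: field_simps)
  qed
  then have "\<bar>c\<bar> \<le> sqrt (a * b)"
    by (rule real_le_rsqrt[of "\<bar>c\<bar>", unfolded power2_abs])
  then show ?thesis
    by (simp add: real_sqrt_mult)
qed

context
  fixes D :: gmsfem
  assumes setting: "mesh_setting D"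
begin

lemma fine_mesh: "conforming_mesh (Dom D) (mesh D)"
  using setting by (simp add: mesh_setting_def)

lemma open_Dom: "open (Dom D)"
  using setting by (simp add: mesh_setting_def polygonal_domain_def)

text \<open>
  A triangle of the mesh lies in the closure of the domain.  Its interior lies in the domain
  itself since the domain has no slits, and only there are the coefficients controlled.
\<close>
lemma cell_interior:
  assumes "\<tau> \<in> mesh D"
  shows "interior \<tau> \<subseteq> Dom D" and "open (interior \<tau>)" and "bounded (interior \<tau>)"
proof -
  have "interior \<tau> \<subseteq> interior (closure (Dom D))"
    using conforming_meshD(4)[OF fine_mesh assms] by (rule interior_mono)
  then show "interior \<tau> \<subseteq> Dom D"
    using setting by (simp add: mesh_setting_def polygonal_domain_def)
  show "bounded (interior \<tau>)"
    using conforming_meshD(2)[OF fine_mesh assms]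
    by (intro bounded_interior compact_imp_bounded compact_simplex)
qed simp

lemma dom_integral_sum:
  "dom_integral D g = (\<Sum>\<tau>\<in>mesh D. integral\<^sup>L (lebesgue_on (interior \<tau>)) (g \<tau>))"
proof -
  have "{\<tau> \<in> mesh D. \<tau> \<subseteq> closure (Dom D)} = mesh D"
    using conforming_meshD(4)[OF fine_mesh] by blast
  then show ?thesis
    by (simp add: dom_integral_def pw_integral_def set_lebesgue_integral_eq_lebesgue_on)
qed

lemma dom_integral_nonneg:
  assumes "\<And>\<tau> x. \<tau> \<in> mesh D \<Longrightarrow> x \<in> Dom D \<Longrightarrow> 0 \<le> g \<tau> x"
  shows "0 \<le> dom_integral D g"
  unfolding dom_integral_sum
proof (intro sum_nonneg Bochner_Integration.integral_nonneg)
  fix \<tau> x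
  assume "\<tau> \<in> mesh D" "x \<in> space (lebesgue_on (interior \<tau>))"
  then show "0 \<le> g \<tau> x"
    using assms cell_interior(1) by (auto simp: space_restrict_space)
qed

lemma dom_integral_eq_0:
  assumes "\<And>\<tau>. AE x in lebesgue_on (Dom D). g \<tau> x = 0"
  shows "dom_integral D g = 0"
  unfolding dom_integral_sum
proof (intro sum.neutral ballI integral_eq_zero_AE)
  fix \<tau>
  assume \<tau>: "\<tau> \<in> mesh D"
  have "AE x in lebesgue. x \<in> Dom D \<longrightarrow> g \<tau> x = 0"
    using assms[of \<tau>] open_Dom by (simp add: AE_restrict_space_iff)
  then have "AE x in lebesgue. x \<in> interior \<tau> \<longrightarrow> g \<tau> x = 0"
    by eventually_elim (use cell_interior(1)[OF \<tau>] in blast)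
  then show "AE x in lebesgue_on (interior \<tau>). g \<tau> x = 0"
    by (simp add: AE_restrict_space_iff)
qed

lemma normV_squared:
  assumes "coefficient (Dom D) (kappa D)"
  shows "(normV D v)\<^sup>2 = dom_integral D (\<lambda>\<tau> x. kappa D x * (norm (v \<tau> x))\<^sup>2)"
  unfolding normV_def
  by (intro real_sqrt_pow2 dom_integral_nonneg mult_nonneg_nonneg less_imp_le[OF coefficient_pos[OF assms]]) auto

lemma normQ_squared:
  assumes "coefficient (Dom D) (rho D)"
  shows "(normQ D q)\<^sup>2 = dom_integral D (\<lambda>\<tau> x. rho D x * (q \<tau> x)\<^sup>2)"
  unfolding normQ_def
  by (intro real_sqrt_pow2 dom_integral_nonneg mult_nonneg_nonneg less_imp_le[OF coefficient_pos[OF assms]]) auto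

lemma weighted_norm_derivative:
  fixes u :: "real \<Rightarrow> 'b::real_inner pw"
  assumes c: "coefficient (Dom D) c" and T: "0 < T"
    and u: "\<And>s. s \<in> {0..T} \<Longrightarrow> u s \<in> pwP1 D" and diff: "time_diff T u" and t: "t \<in> {0..T}"
  shows "((\<lambda>s. dom_integral D (\<lambda>\<tau> x. c x * (norm (u s \<tau> x))\<^sup>2)) has_real_derivative
    2 * dom_integral D (\<lambda>\<tau> x. c x * (time_deriv T u t \<tau> x \<bullet> u t \<tau> x))) (at t within {0..T})"
  unfolding dom_integral_sum sum_distrib_left
proof (rule DERIV_sum)
  fix \<tau>
  assume \<tau>: "\<tau> \<in> mesh D"
  have "at t within {0..T} \<noteq> bot"
    using T t by (simp add: trivial_limit_within)
  moreover have "((\<lambda>s. u s \<tau> x) has_vector_derivative time_deriv T u t \<tau> x) (at t within {0..T})" for x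
    using diff t unfolding time_diff_def time_deriv_def vector_derivative_works[symmetric] by blast
  moreover have "u s \<tau> \<in> P1" if "s \<in> {0..T}" for s
    using u[OF that] \<tau> by (simp add: pwP1_def)
  ultimately have "((\<lambda>s. LINT x:interior \<tau>|lebesgue. c x * (norm (u s \<tau> x))\<^sup>2) has_real_derivative
      2 * (LINT x:interior \<tau>|lebesgue. c x * (time_deriv T u t \<tau> x \<bullet> u t \<tau> x))) (at t within {0..T})"
    using mass_derivative[OF c cell_interior[OF \<tau>], of "{0..T}" "\<lambda>s. u s \<tau>" t "time_deriv T u t \<tau>"] t
    by blast
  then show "((\<lambda>s. LINT x|lebesgue_on (interior \<tau>). c x * (norm (u s \<tau> x))\<^sup>2) has_real_derivative
      2 * (LINT x|lebesgue_on (interior \<tau>). c x * (time_deriv T u t \<tau> x \<bullet> u t \<tau> x))) (at t within {0..T})"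
    by (simp add: set_lebesgue_integral_eq_lebesgue_on)
qed

text \<open>
  The first function is \<open>g\<^sup>2 / c\<close>, and \<open>c\<close> is bounded below.  The sum of the first and the third
  dominates the second, by the inequality between arithmetic and geometric mean.
\<close>
lemma source_integrable:
  assumes c: "coefficient (Dom D) c"
    and g: "g \<in> borel_measurable (lebesgue_on (Dom D))" "integrable (lebesgue_on (Dom D)) (\<lambda>x. (g x)\<^sup>2)"
    and q: "q \<in> pwP1 D" and \<tau>: "\<tau> \<in> mesh D"
  shows "integrable (lebesgue_on (interior \<tau>)) (\<lambda>x. c x * (g x / c x)\<^sup>2)"
    and "integrable (lebesgue_on (interior \<tau>)) (\<lambda>x. g x * q \<tau> x)"
    and "integrable (lebesgue_on (interior \<tau>)) (\<lambda>x. c x * (q \<tau> x)\<^sup>2)"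
proof -
  let ?M = "lebesgue_on (interior \<tau>)"
  obtain c0 where c0: "0 < c0" "\<And>x. x \<in> Dom D \<Longrightarrow> c0 \<le> c x"
    using c unfolding coefficient_def by blast
  have q\<tau>: "q \<tau> \<in> P1"
    using q \<tau> by (simp add: pwP1_def)
  have meas: "h \<in> borel_measurable (lebesgue_on (Dom D)) \<Longrightarrow> h \<in> borel_measurable ?M" for h :: "pt \<Rightarrow> real"
    using cell_interior(1)[OF \<tau>] by (rule measurable_restrict_mono[rotated])
  have cm [measurable]: "c \<in> borel_measurable ?M"
    using c by (intro meas) (simp add: coefficient_def)
  have gm [measurable]: "g \<in> borel_measurable ?M"
    using g(1) by (rule meas)
  have qm [measurable]: "q \<tau> \<in> borel_measurable ?M"
    using P1_integrable[OF cell_interior(2,3)[OF \<tau>] q\<tau>] by simp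
  have Dom: "Dom D \<in> sets lebesgue"
    using open_Dom by auto
  have "set_integrable lebesgue (Dom D) (\<lambda>x. (g x)\<^sup>2)"
    using g(2) Dom by (simp add: set_integrable_def integrable_restrict_space)
  then have "set_integrable lebesgue (interior \<tau>) (\<lambda>x. (g x)\<^sup>2)"
    by (rule set_integrable_subset) (use cell_interior(1)[OF \<tau>] in auto)
  then have g2: "integrable ?M (\<lambda>x. (g x)\<^sup>2)"
    by (simp add: set_integrable_def integrable_restrict_space)
  show cg: "integrable ?M (\<lambda>x. c x * (g x / c x)\<^sup>2)"
  proof (rule Bochner_Integration.integrable_bound[OF integrable_mult_right[OF g2, of "1 / c0"]])
    show "AE x in ?M. norm (c x * (g x / c x)\<^sup>2) \<le> norm (1 / c0 * (g x)\<^sup>2)"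
    proof (rule AE_I2)
      fix x
      assume "x \<in> space ?M"
      then have "c0 \<le> c x"
        using c0(2) cell_interior(1)[OF \<tau>] by (auto simp: space_restrict_space)
      moreover have "c x * (g x / c x)\<^sup>2 = (g x)\<^sup>2 / c x"
        using c0(1) \<open>c0 \<le> c x\<close> by (simp add: power2_eq_square)
      ultimately show "norm (c x * (g x / c x)\<^sup>2) \<le> norm (1 / c0 * (g x)\<^sup>2)"
        using c0(1) by (simp add: frac_le)
    qed
  qed measurable
  show cq: "integrable ?M (\<lambda>x. c x * (q \<tau> x)\<^sup>2)"
    using mass_integrable[OF c cell_interior[OF \<tau>] q\<tau> q\<tau>] by (simp add: power2_eq_square)
  show "integrable ?M (\<lambda>x. g x * q \<tau> x)"
  proof (rule Bochner_Integration.integrable_bound[OF Bochner_Integration.integrable_add[OF cg cq]])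
    show "AE x in ?M. norm (g x * q \<tau> x) \<le> norm (c x * (g x / c x)\<^sup>2 + c x * (q \<tau> x)\<^sup>2)"
    proof (rule AE_I2)
      fix x
      assume "x \<in> space ?M"
      then have cx: "0 < c x"
        using coefficient_pos[OF c] cell_interior(1)[OF \<tau>] by (auto simp: space_restrict_space)
      define a where "a = g x / c x"
      have "0 \<le> \<bar>a\<bar> * \<bar>q \<tau> x\<bar>"
        by simp
      moreover have "2 * (\<bar>a\<bar> * \<bar>q \<tau> x\<bar>) \<le> a\<^sup>2 + (q \<tau> x)\<^sup>2"
        using sum_squares_bound[of "\<bar>a\<bar>" "\<bar>q \<tau> x\<bar>"] by (simp only: power2_abs mult.assoc)
      ultimately have "\<bar>a\<bar> * \<bar>q \<tau> x\<bar> \<le> a\<^sup>2 + (q \<tau> x)\<^sup>2"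
        by linarith
      then have "c x * (\<bar>a\<bar> * \<bar>q \<tau> x\<bar>) \<le> c x * (a\<^sup>2 + (q \<tau> x)\<^sup>2)"
        using cx by (intro mult_left_mono) auto
      moreover have "g x = c x * a"
        using cx by (simp add: a_def)
      ultimately show "norm (g x * q \<tau> x) \<le> norm (c x * (g x / c x)\<^sup>2 + c x * (q \<tau> x)\<^sup>2)"
        using cx by (simp add: abs_mult algebra_simps a_def[symmetric])
    qed
  qed measurable
qed

text \<open>
  The polynomial in \<open>s\<close> is the squared norm of \<open>s g / \<rho> + q\<close>, summed over all triangles.
\<close>
lemma source_Cauchy_Schwarz:
  assumes c: "coefficient (Dom D) (rho D)"
    and g: "g \<in> borel_measurable (lebesgue_on (Dom D))" "integrable (lebesgue_on (Dom D)) (\<lambda>x. (g x)\<^sup>2)"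
    and q: "q \<in> pwP1 D"
  shows "dom_integral D (\<lambda>\<tau> x. g x * q \<tau> x) \<le> normQ D (\<lambda>\<tau> x. g x / rho D x) * normQ D q"
  unfolding normQ_def
proof (rule quadratic_nonneg_imp_Cauchy_Schwarz)
  fix s :: real
  let ?A = "\<lambda>\<tau> x. rho D x * (g x / rho D x)\<^sup>2" and ?B = "\<lambda>\<tau> x. rho D x * (q \<tau> x)\<^sup>2"
    and ?C = "\<lambda>\<tau> x. g x * q \<tau> x"
  note int = source_integrable[OF c g q]
  have "0 \<le> dom_integral D (\<lambda>\<tau> x. s\<^sup>2 * ?A \<tau> x + 2 * s * ?C \<tau> x + ?B \<tau> x)"
  proof (rule dom_integral_nonneg)
    fix \<tau> x
    assume "x \<in> Dom D"
    then have "0 < rho D x"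
      using c coefficient_pos by blast
    then have "s\<^sup>2 * ?A \<tau> x + 2 * s * ?C \<tau> x + ?B \<tau> x = rho D x * (s * (g x / rho D x) + q \<tau> x)\<^sup>2"
      by (simp add: power2_eq_square field_simps)
    then show "0 \<le> s\<^sup>2 * ?A \<tau> x + 2 * s * ?C \<tau> x + ?B \<tau> x"
      using \<open>0 < rho D x\<close> by simp
  qed
  also have "\<dots> = s\<^sup>2 * dom_integral D ?A + 2 * s * dom_integral D ?C + dom_integral D ?B"
    unfolding dom_integral_sum sum_distrib_left sum.distrib[symmetric]
    by (intro sum.cong refl) (simp add: int)
  finally show "0 \<le> s\<^sup>2 * dom_integral D ?A + 2 * s * dom_integral D ?C + dom_integral D ?B" .
qed (auto intro!: dom_integral_nonneg mult_nonneg_nonneg less_imp_le[OF coefficient_pos[OF c]])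

end

section \<open>Energy\<close>

lemma solution_spaces:
  assumes "solution D T f v p" and "t \<in> {0..T}"
  shows "v t \<in> VH D" and "p t \<in> QH D"
  using bspec[OF assms(1)[unfolded solution_def, THEN conjunct2, THEN conjunct2] assms(2)]
  by - (rule conjunct1, assumption, rule conjunct2[THEN conjunct1], assumption)

text \<open>
  The equations are tested with the solution itself, \<open>w = v(t)\<close> and \<open>q = p(t)\<close>.  The coupling
  terms of the two equations are then the same two numbers with opposite signs and cancel in
  the sum; only the time derivatives and the source remain.
\<close>
lemma energy_identity:
  assumes "gmsfem_setting D" and T: "0 < T" and sol: "solution D T f v p" and t: "t \<in> {0..T}"
  shows "((\<lambda>s. (normV D (v s))\<^sup>2 + (normQ D (p s))\<^sup>2) has_real_derivative
    2 * dom_integral D (\<lambda>\<tau> x. f t x * p t \<tau> x)) (at t within {0..T})"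
proof -
  have D: "mesh_setting D" "coefficient (Dom D) (kappa D)" "coefficient (Dom D) (rho D)"
    "basis1 D" "basis2 D" "basis3 D"
    using assms(1) by (auto simp: gmsfem_setting_def)
  note VQ = solution_spaces[OF sol]
  have P1: "v s \<in> pwP1 D" "p s \<in> pwP1 D" if "s \<in> {0..T}" for s
    using VH_pwP1[OF D(4,5,6)] QH_pwP1[OF D(1,5,6)] VQ[OF that] by blast+
  have diff: "time_diff T v" "time_diff T p"
    using sol[unfolded solution_def, THEN conjunct1]
      sol[unfolded solution_def, THEN conjunct2, THEN conjunct1] .
  from bspec[OF sol[unfolded solution_def, THEN conjunct2, THEN conjunct2] t]
  have eqs: "\<forall>w\<in>VH D.
      dom_integral D (\<lambda>\<tau> x. kappa D x * (time_deriv T v t \<tau> x \<bullet> w \<tau> x))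
      - dom_integral D (\<lambda>\<tau> x. compI D (p t) \<tau> x * pw_div w \<tau> x)
      + (\<Sum>E\<in>edges_p0 D.
           edge_integral D E (\<lambda>e x. etrace D (compB D (p t)) e x * jump D E w e x)) = 0"
    "\<forall>q\<in>QH D.
      dom_integral D (\<lambda>\<tau> x. rho D x * (time_deriv T p t \<tau> x * q \<tau> x))
      + dom_integral D (\<lambda>\<tau> x. compI D q \<tau> x * pw_div (v t) \<tau> x)
      - (\<Sum>E\<in>edges_p0 D.
           edge_integral D E (\<lambda>e x. etrace D (compB D q) e x * jump D E (v t) e x))
      = dom_integral D (\<lambda>\<tau> x. f t x * q \<tau> x)"
    by - (rule conjunct2[THEN conjunct2, THEN conjunct1], assumption,
      rule conjunct2[THEN conjunct2, THEN conjunct2], assumption)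
  have "dom_integral D (\<lambda>\<tau> x. kappa D x * (time_deriv T v t \<tau> x \<bullet> v t \<tau> x))
      + dom_integral D (\<lambda>\<tau> x. rho D x * (time_deriv T p t \<tau> x \<bullet> p t \<tau> x))
      = dom_integral D (\<lambda>\<tau> x. f t x * p t \<tau> x)"
    using bspec[OF eqs(1) VQ(1)[OF t]] bspec[OF eqs(2) VQ(2)[OF t]]
    unfolding inner_real_def by linarith
  then have "2 * dom_integral D (\<lambda>\<tau> x. f t x * p t \<tau> x) =
      2 * dom_integral D (\<lambda>\<tau> x. kappa D x * (time_deriv T v t \<tau> x \<bullet> v t \<tau> x))
      + 2 * dom_integral D (\<lambda>\<tau> x. rho D x * (time_deriv T p t \<tau> x \<bullet> p t \<tau> x))"
    by linarith
  moreover have "((\<lambda>s. (normV D (v s))\<^sup>2) has_real_derivative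
      2 * dom_integral D (\<lambda>\<tau> x. kappa D x * (time_deriv T v t \<tau> x \<bullet> v t \<tau> x))) (at t within {0..T})"
    unfolding normV_squared[OF D(1,2)]
    by (rule weighted_norm_derivative[OF D(1,2) T P1(1) diff(1) t])
  moreover have "((\<lambda>s. (normQ D (p s))\<^sup>2) has_real_derivative
      2 * dom_integral D (\<lambda>\<tau> x. rho D x * (time_deriv T p t \<tau> x \<bullet> p t \<tau> x))) (at t within {0..T})"
    using weighted_norm_derivative[OF D(1,3) T P1(2) diff(2) t]
    unfolding normQ_squared[OF D(1,3)] real_norm_def power2_abs .
  ultimately show ?thesis
    by (simp only:) (rule DERIV_add)
qed

text \<open>
  The energy \<open>e\<close> is integrated up to the time \<open>t0\<close> of its maximum \<open>m\<^sup>2\<close>, with \<open>sqrt (e t)\<close>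
  estimated by \<open>m\<close>.  This gives \<open>m\<^sup>2 \<le> 2 m \<integral>F\<close>, hence \<open>m \<le> 2 \<integral>F\<close>, and explains the factor 4.  The
  derivative \<open>e'\<close> need not be continuous or Lebesgue integrable.  The fundamental theorem of
  calculus for the Henstock-Kurzweil integral covers this case, and that integral agrees with
  the Lebesgue integral on \<open>F\<close>.
\<close>
lemma energy_bound:
  fixes e e' F :: "real \<Rightarrow> real"
  assumes T: "0 < T"
    and deriv: "\<And>t. t \<in> {0..T} \<Longrightarrow> (e has_real_derivative e' t) (at t within {0..T})"
    and nonneg: "\<And>t. t \<in> {0..T} \<Longrightarrow> 0 \<le> e t" "\<And>t. t \<in> {0..T} \<Longrightarrow> 0 \<le> F t"
    and bound: "\<And>t. t \<in> {0..T} \<Longrightarrow> e' t \<le> 2 * F t * sqrt (e t)"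
    and int: "set_integrable lebesgue {0..T} F"
    and "e 0 = 0"
  shows "\<exists>t0\<in>{0..T}. (\<forall>t\<in>{0..T}. e t \<le> e t0) \<and> e t0 \<le> 4 * (LINT t:{0..T}|lebesgue. F t)\<^sup>2"
proof -
  let ?I = "LINT t:{0..T}|lebesgue. F t"
  have "continuous_on {0..T} e"
    using deriv by (rule DERIV_continuous_on)
  then obtain t0 where t0: "t0 \<in> {0..T}" "\<And>t. t \<in> {0..T} \<Longrightarrow> e t \<le> e t0"
    using continuous_attains_sup[of "{0..T}" e] T by auto
  define m where "m = sqrt (e t0)"
  have m: "0 \<le> m" "e t0 = m\<^sup>2"
    using nonneg(1)[OF t0(1)] by (auto simp: m_def)
  have "(e' has_integral (e t0 - e 0)) {0..t0}"
  proof (rule fundamental_theorem_of_calculus)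
    show "(e has_vector_derivative e' t) (at t within {0..t0})" if "t \<in> {0..t0}" for t
      using that t0(1) has_field_derivative_subset[OF deriv, of t "{0..t0}"]
      by (auto simp: has_real_derivative_iff_has_vector_derivative[symmetric])
  qed (use t0 in auto)
  moreover have int0: "set_integrable lebesgue {0..t0} F"
    using int by (rule set_integrable_subset) (use t0 in auto)
  then have "((\<lambda>t. 2 * m * F t) has_integral (2 * m * integral {0..t0} F)) {0..t0}"
    using set_lebesgue_integral_eq_integral(1) by (intro has_integral_mult_right integrable_integral)
  moreover have "e' t \<le> 2 * m * F t" if "t \<in> {0..t0}" for t
  proof -
    have t: "t \<in> {0..T}"
      using that t0(1) by auto
    have "sqrt (e t) \<le> m"
      using t0(2)[OF t] by (simp add: m_def)
    then have "2 * F t * sqrt (e t) \<le> 2 * F t * m"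
      using nonneg(2)[OF t] by (intro mult_left_mono) auto
    then show ?thesis
      using bound[OF t] by (simp add: mult_ac)
  qed
  ultimately have "e t0 - e 0 \<le> 2 * m * integral {0..t0} F"
    by (rule has_integral_le)
  also have "\<dots> \<le> 2 * m * ?I"
    unfolding set_lebesgue_integral_eq_integral(2)[OF int]
    using t0 nonneg m set_lebesgue_integral_eq_integral(1)[OF int0] set_lebesgue_integral_eq_integral(1)[OF int]
    by (intro mult_left_mono integral_subset_le) auto
  finally have "m * m \<le> m * (2 * ?I)"
    using m \<open>e 0 = 0\<close> by (simp add: power2_eq_square mult_ac)
  moreover have I: "0 \<le> ?I"
    unfolding set_lebesgue_integral_eq_integral(2)[OF int]
    using nonneg(2) by (intro integral_nonneg set_lebesgue_integral_eq_integral(1)[OF int]) auto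
  ultimately have "m \<le> 2 * ?I"
    using m(1) by (cases "m = 0") auto
  then have "m\<^sup>2 \<le> (2 * ?I)\<^sup>2"
    using m(1) by (intro power_mono)
  then show ?thesis
    using t0 m(2) by (intro bexI[of _ t0]) (auto simp: power_mult_distrib)
qed

theorem theorem5p1:
  fixes D :: gmsfem and T :: real and f :: "real \<Rightarrow> pt \<Rightarrow> real"
    and v :: "real \<Rightarrow> pt pw" and p :: "real \<Rightarrow> real pw"
  assumes "gmsfem_setting D" and "0 < T" and "source D T f"
    and "solution D T f v p"
  shows "((\<forall>t\<in>{0..T}. AE x in lebesgue_on (Dom D). f t x = 0) \<longrightarrow>
            (\<forall>t\<in>{0..T}. ((\<lambda>s. 1/2 * ((normV D (v s))\<^sup>2 + (normQ D (p s))\<^sup>2))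
               has_real_derivative 0) (at t within {0..T})))
       \<and> (v 0 = 0 \<and> p 0 = 0 \<longrightarrow>
            (\<exists>t0\<in>{0..T}.
               (\<forall>t\<in>{0..T}. (normV D (v t))\<^sup>2 + (normQ D (p t))\<^sup>2
                  \<le> (normV D (v t0))\<^sup>2 + (normQ D (p t0))\<^sup>2) \<and>
               (normV D (v t0))\<^sup>2 + (normQ D (p t0))\<^sup>2
                  \<le> 4 * (LINT t:{0..T}|lebesgue. normQ D (\<lambda>\<tau> x. f t x / rho D x))\<^sup>2))"
proof (intro conjI impI ballI)
  fix t
  assume f0: "\<forall>t\<in>{0..T}. AE x in lebesgue_on (Dom D). f t x = 0" and t: "t \<in> {0..T}"
  have D: "mesh_setting D"
    using assms(1) by (simp add: gmsfem_setting_def)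
  have "dom_integral D (\<lambda>\<tau> x. f t x * p t \<tau> x) = 0"
  proof (rule dom_integral_eq_0[OF D])
    show "AE x in lebesgue_on (Dom D). f t x * p t \<tau> x = 0" for \<tau>
      using bspec[OF f0 t] by eventually_elim simp
  qed
  then show "((\<lambda>s. 1/2 * ((normV D (v s))\<^sup>2 + (normQ D (p s))\<^sup>2)) has_real_derivative 0)
      (at t within {0..T})"
    using DERIV_cmult[OF energy_identity[OF assms(1,2,4) t], of "1/2"] by simp
next
  assume init: "v 0 = 0 \<and> p 0 = 0"
  have D: "mesh_setting D" "coefficient (Dom D) (rho D)" "basis2 D" "basis3 D"
    using assms(1) by (auto simp: gmsfem_setting_def)
  have f: "f t \<in> borel_measurable (lebesgue_on (Dom D))"
    "integrable (lebesgue_on (Dom D)) (\<lambda>x. (f t x)\<^sup>2)" if "t \<in> {0..T}" for t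
    using assms(3) that unfolding source_def by blast+
  have normQ_nonneg: "0 \<le> normQ D q" for q
    unfolding normQ_def
    by (intro real_sqrt_ge_zero dom_integral_nonneg[OF D(1)] mult_nonneg_nonneg
        less_imp_le[OF coefficient_pos[OF D(2)]]) auto
  show "\<exists>t0\<in>{0..T}.
      (\<forall>t\<in>{0..T}. (normV D (v t))\<^sup>2 + (normQ D (p t))\<^sup>2
         \<le> (normV D (v t0))\<^sup>2 + (normQ D (p t0))\<^sup>2) \<and>
      (normV D (v t0))\<^sup>2 + (normQ D (p t0))\<^sup>2
         \<le> 4 * (LINT t:{0..T}|lebesgue. normQ D (\<lambda>\<tau> x. f t x / rho D x))\<^sup>2"
  proof (rule energy_bound[OF assms(2) energy_identity[OF assms(1,2,4)]])
    fix t
    assume t: "t \<in> {0..T}"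
    \<comment> \<open>\<open>e' \<le> 2 F \<parallel>p\<parallel>\<close> by Cauchy-Schwarz, and the pressure is bounded by the energy.\<close>
    have "p t \<in> pwP1 D"
      using QH_pwP1[OF D(1,3,4)] solution_spaces(2)[OF assms(4) t] by blast
    then have "dom_integral D (\<lambda>\<tau> x. f t x * p t \<tau> x)
        \<le> normQ D (\<lambda>\<tau> x. f t x / rho D x) * normQ D (p t)"
      by (intro source_Cauchy_Schwarz D f t)
    also have "\<dots> \<le> normQ D (\<lambda>\<tau> x. f t x / rho D x) * sqrt ((normV D (v t))\<^sup>2 + (normQ D (p t))\<^sup>2)"
      by (intro mult_left_mono normQ_nonneg real_le_rsqrt) simp
    finally show "2 * dom_integral D (\<lambda>\<tau> x. f t x * p t \<tau> x)
        \<le> 2 * normQ D (\<lambda>\<tau> x. f t x / rho D x) * sqrt ((normV D (v t))\<^sup>2 + (normQ D (p t))\<^sup>2)"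
      by simp
  next
    show "set_integrable lebesgue {0..T} (\<lambda>t. normQ D (\<lambda>\<tau> x. f t x / rho D x))"
      using assms(3) unfolding source_def by blast
    show "(normV D (v 0))\<^sup>2 + (normQ D (p 0))\<^sup>2 = 0"
      using init by (simp add: normV_def normQ_def dom_integral_sum[OF D(1)])
  qed (use normQ_nonneg in auto)
qed

end
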